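(* Let $G$ be a complex simple Lie group not of type $A_\ell$ or $C_\ell$, with associated data $(W,\mathfrak{C})$ and $n=1+\dim W$. Let $(\mathcal{I},\mathcal{J})$ be the linear Pfaffian system on the $3n$-dimensional manifold $\mathcal{E}$ with coordinates $(x^i,u,u_i,t^a)$, $0\le i\le n-1$, $1\le a\le n-1$, given by $\mathcal{I}=\mathrm{span}\{\sigma,\theta_0,\dots,\theta_{n-1}\}$ with $$\sigma=du-u_idx^i,\quad \theta_0=du_0-\mathfrak{C}(t^3)dx^0-\tfrac32\mathfrak{C}_a(t^2)dx^a,\quad \theta_a=du_a-\tfrac32\mathfrak{C}_a(t^2)dx^0-3\mathfrak{C}_{ab}(t)dx^b,$$ and $\mathcal{J}=\mathrm{span}\{\sigma,\theta_i,dx^i\}_{0\le i\le n-1}$. Then the tableau for $(\mathcal{I},\mathcal{J})$ is involutive (in the sense of Cartan--Kähler) if and only if $G=G_2$ or $G=B_3$. In these cases there is a single nonzero Cartan character, $s_1=1$ or $s_1=2$ respectively.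
   Context: Everything is complex; summation convention. To $G$ is associated a vector space $W$ (a Jordan algebra) with cubic form $\mathfrak{C}\in S^3W^*$: $B_\ell$ ($\ell\ge3$): $W=\mathcal{JS}_{2\ell-5}$; $D_\ell$ ($\ell\ge5$): $W=\mathcal{JS}_{2\ell-6}$; here $\mathcal{JS}_m=\mathbb{C}^m\oplus\mathbb{C}$ with $\mathbb{C}^m$ carrying a nondegenerate symmetric bilinear form $\langle\cdot,\cdot\rangle$ and $\mathfrak{C}(t^3)=\langle v,v\rangle\lambda$ for $t=(v,\lambda)$. $G_2$: $W=\mathbb{C}$, $\mathfrak{C}(t^3)=t^3/3$. $D_4$: $W$ = diagonal $3\times3$ matrices, $\mathfrak{C}(t^3)=\det t$. $F_4,E_6,E_7,E_8$: $W$ = $3\times 3$ $\mathbb{A}$-Hermitian matrices with $\mathbb{A}=\mathbb{A}_{\mathbb{R}}\otimes_{\mathbb{R}}\mathbb{C}$ and $\mathbb{A}_{\mathbb{R}}=\mathbb{R},\mathbb{C},\mathbb{H},\mathbb{O}$ respectively, $\mathfrak{C}(t^3)=\det(t)$ defined by $t^3-\mathrm{tr}(t)t^2-\frac12(\mathrm{tr}(t^2)-\mathrm{tr}(t)^2)t-\det(t)\,\mathrm{id}=0$. With a basis $\{\mathsf{w}_a\}_{a=1}^{n-1}$ of $W$ and $t=t^a\mathsf{w}_a$: $\mathfrak{C}(t^3)=\mathfrak{C}_{abc}t^at^bt^c$, $\mathfrak{C}_a(t^2)=\mathfrak{C}_{abc}t^bt^c$, $\mathfrak{C}_{ab}(t)=\mathfrak{C}_{abc}t^c$.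 ($\mathcal{E}$ is the second-order PDE $u_{00}=\mathfrak{C}(t^3)$, $u_{a0}=\frac32\mathfrak{C}_a(t^2)$, $u_{ab}=3\mathfrak{C}_{ab}(t)$ of the flat $G$-contact structure.) Linear Pfaffian means $d\mathcal{I}\equiv0\bmod\mathcal{J}$. The tableau of $(\mathcal I,\mathcal J)$, its Cartan characters $s_1\ge s_2\ge\dots\ge0$ (computed in a generic basis) and involutivity are the standard notions: Cartan's test says the tableau is involutive iff $s_1+2s_2+3s_3+\dots=r^{(1)}$. Here, with $\pi^c=dt^c$, $\omega^0=dx^0$, $\omega^b=3(dx^b+t^bdx^0)$, the structure equations modulo $\mathcal{I}$ are $d\sigma\equiv0$, $d(\theta_0-t^a\theta_a)\equiv0$, $d\theta_a\equiv\mathfrak{C}_{abc}\,\omega^b\wedge\pi^c$, and $r^{(1)}$ is the dimension of the space of all $A^c{}_i$ such that the replacement $\pi^c\mapsto\pi^c+A^c{}_i\omega^i$ preserves these equations. *)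

theory Defs
  imports "HOL-Analysis.Analysis" "HOL-Library.Function_Algebras"
begin

section \<open>The cubic form attached to a simple group\<close>

datatype simple_type =
  TypeA nat | TypeB nat | TypeC nat | TypeD nat | TypeE6 | TypeE7 | TypeE8 | TypeF4 | TypeG2

text \<open>
  Usual ranges of the rank, which avoid the coincidences \<open>B\<^sub>1 = C\<^sub>1 = A\<^sub>1\<close>, \<open>B\<^sub>2 = C\<^sub>2\<close>,
  \<open>D\<^sub>2 = A\<^sub>1 \<times> A\<^sub>1\<close> and \<open>D\<^sub>3 = A\<^sub>3\<close>.
\<close>

fun valid_type :: "simple_type \<Rightarrow> bool" where
  "valid_type (TypeA l) \<longleftrightarrow> 1 \<le> l"
| "valid_type (TypeB l) \<longleftrightarrow> 3 \<le> l"
| "valid_type (TypeC l) \<longleftrightarrow> 2 \<le> l"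
| "valid_type (TypeD l) \<longleftrightarrow> 4 \<le> l"
| "valid_type _ \<longleftrightarrow> True"

subsection \<open>Coefficients of a cubic form in a basis\<close>

definition cubic :: "('b::finite \<Rightarrow> 'b \<Rightarrow> 'b \<Rightarrow> complex) \<Rightarrow> complex^'b \<Rightarrow> complex" where
  "cubic C t = (\<Sum>a\<in>UNIV. \<Sum>b\<in>UNIV. \<Sum>c\<in>UNIV. C a b c * t$a * t$b * t$c)"

definition cubic1 :: "('b::finite \<Rightarrow> 'b \<Rightarrow> 'b \<Rightarrow> complex) \<Rightarrow> 'b \<Rightarrow> complex^'b \<Rightarrow> complex" where
  "cubic1 C a t = (\<Sum>b\<in>UNIV. \<Sum>c\<in>UNIV. C a b c * t$b * t$c)"

definition cubic2 :: "('b::finite \<Rightarrow> 'b \<Rightarrow> 'b \<Rightarrow> complex) \<Rightarrow> 'b \<Rightarrow> 'b \<Rightarrow> complex^'b \<Rightarrow> complex" where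
  "cubic2 C a b t = (\<Sum>c\<in>UNIV. C a b c * t$c)"

text \<open>
  \<open>W\<close> is a complex subspace of the ambient space \<open>'w\<close> with scalar multiplication \<open>smul\<close>, and
  \<open>N\<close> is the cubic form on \<open>W\<close>.  The array \<open>C\<close> is symmetric and holds the coefficients of \<open>N\<close> in
  some basis \<open>w\<close> of \<open>W\<close>, indexed by the finite type \<open>'b\<close>; hence \<open>CARD('b) = dim W\<close>.
\<close>

definition cubic_in_basis ::
  "(complex \<Rightarrow> 'w \<Rightarrow> 'w::ab_group_add) \<Rightarrow> 'w set \<Rightarrow> ('w \<Rightarrow> complex)
     \<Rightarrow> ('b::finite \<Rightarrow> 'b \<Rightarrow> 'b \<Rightarrow> complex) \<Rightarrow> bool" where
  "cubic_in_basis smul W N C \<longleftrightarrow>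
     (\<forall>a b c. C a b c = C b a c \<and> C a b c = C a c b) \<and>
     (\<exists>w :: 'b \<Rightarrow> 'w.
        inj w \<and> \<not> module.dependent smul (range w) \<and> module.span smul (range w) = W \<and>
        (\<forall>t. N (\<Sum>a\<in>UNIV. smul (t$a) (w a)) = cubic C t))"

subsection \<open>The spin factors \<open>\<C>\<^sup>m \<oplus> \<C>\<close>\<close>

definition cspace :: "nat \<Rightarrow> (nat \<Rightarrow> complex) set" where
  "cspace m = {v. \<forall>i\<ge>m. v i = 0}"

definition gram_form :: "nat \<Rightarrow> (nat \<Rightarrow> nat \<Rightarrow> complex) \<Rightarrow> (nat \<Rightarrow> complex) \<Rightarrow> (nat \<Rightarrow> complex) \<Rightarrow> complex" where
  "gram_form m g v w = (\<Sum>i<m. \<Sum>j<m. g i j * v i * w j)"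

definition nondegenerate_symmetric :: "nat \<Rightarrow> (nat \<Rightarrow> nat \<Rightarrow> complex) \<Rightarrow> bool" where
  "nondegenerate_symmetric m g \<longleftrightarrow>
     (\<forall>i<m. \<forall>j<m. g i j = g j i) \<and>
     (\<forall>v\<in>cspace m. (\<forall>w\<in>cspace m. gram_form m g v w = 0) \<longrightarrow> v = 0)"

definition spin_scale :: "complex \<Rightarrow> (nat \<Rightarrow> complex) \<times> complex \<Rightarrow> (nat \<Rightarrow> complex) \<times> complex" where
  "spin_scale z = (\<lambda>(v, l). (\<lambda>i. z * v i, z * l))"

definition spin_factor :: "nat \<Rightarrow> ((nat \<Rightarrow> complex) \<times> complex) set" where
  "spin_factor m = cspace m \<times> UNIV"

definition spin_cubic :: "nat \<Rightarrow> (nat \<Rightarrow> nat \<Rightarrow> complex) \<Rightarrow> (nat \<Rightarrow> complex) \<times> complex \<Rightarrow> complex" where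
  "spin_cubic m g = (\<lambda>(v, l). gram_form m g v v * l)"

subsection \<open>Complex matrices\<close>

definition mscale :: "complex \<Rightarrow> complex^'n^'m \<Rightarrow> complex^'n^'m" where
  "mscale z X = (\<chi> i j. z * X$i$j)"

interpretation cmat: vector_space "mscale :: complex \<Rightarrow> complex^'n^'m \<Rightarrow> complex^'n^'m"
  by unfold_locales (simp_all add: mscale_def vec_eq_iff algebra_simps)

definition diagonal_matrices :: "(complex^3^3) set" where
  "diagonal_matrices = {X. \<forall>i j. i \<noteq> j \<longrightarrow> X$i$j = 0}"

subsection \<open>Hermitian matrices over a complexified composition algebra\<close>

record 'a conj_algebra =
  amult :: "'a \<Rightarrow> 'a \<Rightarrow> 'a"
  aconj :: "'a \<Rightarrow> 'a"
  aone :: 'a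

definition cayley_dickson :: "('a::real_vector) conj_algebra \<Rightarrow> ('a \<times> 'a) conj_algebra" where
  "cayley_dickson A =
     \<lparr> amult = (\<lambda>(a, b) (c, d).
         (amult A a c - amult A (aconj A d) b, amult A d a + amult A b (aconj A c))),
       aconj = (\<lambda>(a, b). (aconj A a, - b)),
       aone = (aone A, 0) \<rparr>"

definition real_algebra :: "real conj_algebra" where
  "real_algebra = \<lparr> amult = (*), aconj = id, aone = 1 \<rparr>"

definition complex_algebra :: "complex conj_algebra" where
  "complex_algebra = \<lparr> amult = (*), aconj = cnj, aone = 1 \<rparr>"

definition quaternion_algebra :: "(complex \<times> complex) conj_algebra" where
  "quaternion_algebra = cayley_dickson complex_algebra"

definition octonion_algebra :: "((complex \<times> complex) \<times> (complex \<times> complex)) conj_algebra" where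
  "octonion_algebra = cayley_dickson quaternion_algebra"

text \<open>
  \<open>A \<otimes>\<^sub>\<real> \<C>\<close>: the pair \<open>(a, b)\<close> stands for \<open>a \<otimes> 1 + b \<otimes> \<i>\<close>.  The product is
  complex bilinear and the conjugation is the complex linear extension of that of \<open>A\<close>.
\<close>

definition complexify :: "('a::real_vector) conj_algebra \<Rightarrow> ('a \<times> 'a) conj_algebra" where
  "complexify A =
     \<lparr> amult = (\<lambda>(a, b) (c, d). (amult A a c - amult A b d, amult A a d + amult A b c)),
       aconj = (\<lambda>(a, b). (aconj A a, aconj A b)),
       aone = (aone A, 0) \<rparr>"

definition cscale :: "complex \<Rightarrow> 'a \<times> 'a \<Rightarrow> ('a::real_vector) \<times> 'a" where
  "cscale z = (\<lambda>(a, b). (Re z *\<^sub>R a - Im z *\<^sub>R b, Re z *\<^sub>R b + Im z *\<^sub>R a))"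

definition hscale :: "complex \<Rightarrow> ('a::real_vector \<times> 'a)^3^3 \<Rightarrow> ('a \<times> 'a)^3^3" where
  "hscale z X = (\<chi> i j. cscale z (X$i$j))"

definition hermitian_matrices :: "('a::real_vector \<times> 'a) conj_algebra \<Rightarrow> (('a \<times> 'a)^3^3) set" where
  "hermitian_matrices A = {X. \<forall>i j. X$i$j = aconj A (X$j$i)}"

definition hmult :: "('a::real_vector \<times> 'a) conj_algebra \<Rightarrow> ('a \<times> 'a)^3^3 \<Rightarrow> ('a \<times> 'a)^3^3 \<Rightarrow> ('a \<times> 'a)^3^3" where
  "hmult A X Y = (\<chi> i j. \<Sum>k\<in>UNIV. amult A (X$i$k) (Y$k$j))"

definition jordan :: "('a::real_vector \<times> 'a) conj_algebra \<Rightarrow> ('a \<times> 'a)^3^3 \<Rightarrow> ('a \<times> 'a)^3^3 \<Rightarrow> ('a \<times> 'a)^3^3" where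
  "jordan A X Y = hscale (1/2) (hmult A X Y + hmult A Y X)"

definition hid :: "('a::real_vector \<times> 'a) conj_algebra \<Rightarrow> ('a \<times> 'a)^3^3" where
  "hid A = (\<chi> i j. if i = j then aone A else 0)"

text \<open>The diagonal of a Hermitian matrix lies in \<open>\<C> \<cdot> 1\<close>, so its trace is a complex number.\<close>

definition htrace :: "('a::real_vector \<times> 'a) conj_algebra \<Rightarrow> ('a \<times> 'a)^3^3 \<Rightarrow> complex" where
  "htrace A X = (THE z. cscale z (aone A) = (\<Sum>i\<in>UNIV. X$i$i))"

text \<open>
  The powers are those of the Jordan algebra; over the octonions \<open>X (X X)\<close> and \<open>(X X) X\<close>
  differ for the ordinary matrix product.
\<close>

definition hdet :: "('a::real_vector \<times> 'a) conj_algebra \<Rightarrow> ('a \<times> 'a)^3^3 \<Rightarrow> complex" where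
  "hdet A X = (THE d.
     let X2 = jordan A X X; X3 = jordan A X X2 in
     X3 - hscale (htrace A X) X2 - hscale (1/2 * (htrace A X2 - (htrace A X)\<^sup>2)) X
        - hscale d (hid A) = 0)"

definition hermitian_cubic :: "('a::real_vector) conj_algebra \<Rightarrow> ('b::finite \<Rightarrow> 'b \<Rightarrow> 'b \<Rightarrow> complex) \<Rightarrow> bool" where
  "hermitian_cubic A C \<longleftrightarrow>
     cubic_in_basis hscale (hermitian_matrices (complexify A)) (hdet (complexify A)) C"

subsection \<open>The association\<close>

definition spin_factor_cubic :: "nat \<Rightarrow> ('b::finite \<Rightarrow> 'b \<Rightarrow> 'b \<Rightarrow> complex) \<Rightarrow> bool" where
  "spin_factor_cubic m C \<longleftrightarrow>
     (\<exists>g. nondegenerate_symmetric m g \<and>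
          cubic_in_basis spin_scale (spin_factor m) (spin_cubic m g) C)"

text \<open>
  \<open>C\<close> is the coefficient array, in some basis of \<open>W\<close>, of the cubic form on the space \<open>W\<close>
  associated to a group of the given type.  Nothing is associated to types A and C.
\<close>

fun associated_cubic :: "simple_type \<Rightarrow> ('b::finite \<Rightarrow> 'b \<Rightarrow> 'b \<Rightarrow> complex) \<Rightarrow> bool" where
  "associated_cubic (TypeA l) C \<longleftrightarrow> False"
| "associated_cubic (TypeB l) C \<longleftrightarrow> spin_factor_cubic (2 * l - 5) C"
| "associated_cubic (TypeC l) C \<longleftrightarrow> False"
| "associated_cubic (TypeD l) C \<longleftrightarrow>
     (if l = 4 then cubic_in_basis mscale diagonal_matrices det C
      else spin_factor_cubic (2 * l - 6) C)"
| "associated_cubic TypeE6 C \<longleftrightarrow> hermitian_cubic complex_algebra C"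
| "associated_cubic TypeE7 C \<longleftrightarrow> hermitian_cubic quaternion_algebra C"
| "associated_cubic TypeE8 C \<longleftrightarrow> hermitian_cubic octonion_algebra C"
| "associated_cubic TypeF4 C \<longleftrightarrow> hermitian_cubic real_algebra C"
| "associated_cubic TypeG2 C \<longleftrightarrow> cubic_in_basis (*) UNIV (\<lambda>t::complex. t^3 / 3) C"

section \<open>Differential forms on a complex coordinate space\<close>

text \<open>
  A 1-form \<open>\<Sum>\<^sub>\<mu> \<theta>\<^sub>\<mu> dz\<^sup>\<mu>\<close> is the vector field of its coefficients, and a 2-form at a point is the
  antisymmetric matrix of its values on pairs of coordinate vectors.
\<close>

type_synonym 'c covector = "complex^'c"
type_synonym 'c one_form = "complex^'c \<Rightarrow> complex^'c"
type_synonym 'c two_covector = "complex^'c^'c"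

definition pairing :: "'c::finite covector \<Rightarrow> complex^'c \<Rightarrow> complex" where
  "pairing \<alpha> v = (\<Sum>\<mu>\<in>UNIV. \<alpha>$\<mu> * v$\<mu>)"

definition dcoord :: "'c::finite \<Rightarrow> 'c covector" where
  "dcoord \<mu> = axis \<mu> 1"

definition partial :: "'c::finite \<Rightarrow> (complex^'c \<Rightarrow> complex) \<Rightarrow> complex^'c \<Rightarrow> complex" where
  "partial \<mu> f p = deriv (\<lambda>z. f (p + axis \<mu> z)) 0"

definition wedge :: "'c::finite covector \<Rightarrow> 'c covector \<Rightarrow> 'c two_covector" where
  "wedge \<alpha> \<beta> = (\<chi> \<mu> \<nu>. \<alpha>$\<mu> * \<beta>$\<nu> - \<alpha>$\<nu> * \<beta>$\<mu>)"

definition ext_deriv :: "'c::finite one_form \<Rightarrow> complex^'c \<Rightarrow> 'c two_covector" where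
  "ext_deriv \<theta> p =
     (\<chi> \<mu> \<nu>. partial \<mu> (\<lambda>q. \<theta> q $ \<nu>) p - partial \<nu> (\<lambda>q. \<theta> q $ \<mu>) p)"

text \<open>Interior product of a tangent vector with a 2-form.\<close>

definition interior_product :: "complex^'c \<Rightarrow> 'c::finite two_covector \<Rightarrow> 'c covector" where
  "interior_product v \<Omega> = (\<chi> \<nu>. \<Sum>\<mu>\<in>UNIV. v$\<mu> * \<Omega>$\<mu>$\<nu>)"

text \<open>Degree two part of the exterior ideal generated by a set of covectors.\<close>

definition ideal2 :: "'c::finite covector set \<Rightarrow> 'c two_covector set" where
  "ideal2 S = cmat.span {wedge \<alpha> \<beta> |\<alpha> \<beta>. \<alpha> \<in> S}"

section \<open>Linear Pfaffian systems and their tableaux\<close>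

text \<open>
  \<open>I\<close> is spanned by the family of 1-forms \<open>\<theta>\<close>, and \<open>J\<close> is given by its fibres.  By the
  Leibniz rule it is enough to test \<open>d\<I> \<equiv> 0 mod \<J>\<close> on generators of \<open>I\<close>.
\<close>

definition fibre :: "('s \<Rightarrow> 'c one_form) \<Rightarrow> complex^'c \<Rightarrow> 'c::finite covector set" where
  "fibre \<theta> p = vec.span (range (\<lambda>\<alpha>. \<theta> \<alpha> p))"

definition linear_pfaffian ::
  "('s \<Rightarrow> 'c one_form) \<Rightarrow> (complex^'c \<Rightarrow> 'c::finite covector set) \<Rightarrow> bool" where
  "linear_pfaffian \<theta> J \<longleftrightarrow>
     (\<forall>p. fibre \<theta> p \<subseteq> J p \<and> (\<forall>\<alpha>. ext_deriv (\<theta> \<alpha>) p \<in> ideal2 (J p)))"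

text \<open>
  \<open>(\<theta>, \<omega>, \<pi>)\<close> is a coframe, and \<open>(\<theta>, \<omega>)\<close> spans \<open>J\<close>.
\<close>

definition adapted_coframe ::
  "('s \<Rightarrow> 'c one_form) \<Rightarrow> (complex^'c \<Rightarrow> 'c::finite covector set)
     \<Rightarrow> ('n \<Rightarrow> 'c one_form) \<Rightarrow> ('r \<Rightarrow> 'c one_form) \<Rightarrow> bool" where
  "adapted_coframe \<theta> J \<omega> \<pi> \<longleftrightarrow>
     (\<forall>p. let e = case_sum (\<lambda>\<alpha>. \<theta> \<alpha> p) (case_sum (\<lambda>i. \<omega> i p) (\<lambda>c. \<pi> c p)) in
        inj e \<and> vec.independent (range e) \<and> vec.span (range e) = UNIV \<and>
        vec.span (range (\<lambda>\<alpha>. \<theta> \<alpha> p) \<union> range (\<lambda>i. \<omega> i p)) = J p)"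

text \<open>
  If \<open>d\<theta>\<^sup>\<alpha> \<equiv> A\<^sup>\<alpha>\<^sub>\<epsilon>\<^sub>i \<pi>\<^sup>\<epsilon> \<and> \<omega>\<^sup>i + T\<^sup>\<alpha>\<^sub>i\<^sub>j \<omega>\<^sup>i \<and> \<omega>\<^sup>j mod I\<close>, the tableau at \<open>p\<close> is the space of
  matrices \<open>M\<^sup>\<alpha>\<^sub>i = A\<^sup>\<alpha>\<^sub>\<epsilon>\<^sub>i v\<^sup>\<epsilon>\<close>.  These are obtained by inserting in \<open>d\<theta>\<^sup>\<alpha>\<close> the tangent vectors \<open>v\<close>
  annihilated by \<open>J\<close>, with \<open>v\<^sup>\<epsilon> = \<pi>\<^sup>\<epsilon>(v)\<close>.
\<close>

definition tableau ::
  "('s::finite \<Rightarrow> 'c one_form) \<Rightarrow> (complex^'c \<Rightarrow> 'c::finite covector set)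
     \<Rightarrow> ('n::finite \<Rightarrow> 'c one_form) \<Rightarrow> complex^'c \<Rightarrow> (complex^'n^'s) set" where
  "tableau \<theta> J \<omega> p =
     {M. \<exists>v. (\<forall>\<beta>\<in>J p. pairing \<beta> v = 0) \<and>
        (\<forall>\<alpha>. interior_product v (ext_deriv (\<theta> \<alpha>) p) - (\<Sum>i\<in>UNIV. M$\<alpha>$i *s \<omega> i p)
              \<in> fibre \<theta> p)}"

subsection \<open>Cartan characters\<close>

definition ordered_basis :: "(complex^'n) list \<Rightarrow> bool" where
  "ordered_basis b \<longleftrightarrow> distinct b \<and> vec.independent (set b) \<and> vec.span (set b) = UNIV"

definition tableau_kernel :: "(complex^'n^'s) set \<Rightarrow> (complex^'n::finite) list \<Rightarrow> nat \<Rightarrow> (complex^'n^'s) set" where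
  "tableau_kernel A b k = {M\<in>A. \<forall>v\<in>set (take k b). M *v v = 0}"

text \<open>
  A basis is generic for the tableau if the dimensions of all the spaces
  \<open>A\<^sub>k = {M \<in> A. M v\<^sub>1 = \<dots> = M v\<^sub>k = 0}\<close> are as small as possible; then
  \<open>s\<^sub>k = dim A\<^sub>k\<^sub>-\<^sub>1 - dim A\<^sub>k\<close>.
\<close>

definition generic_basis :: "(complex^'n^'s) set \<Rightarrow> (complex^'n::finite) list \<Rightarrow> bool" where
  "generic_basis A b \<longleftrightarrow> ordered_basis b \<and>
     (\<forall>b' k. ordered_basis b' \<longrightarrow>
        cmat.dim (tableau_kernel A b k) \<le> cmat.dim (tableau_kernel A b' k))"

definition cartan_character :: "(complex^'n::finite^'s) set \<Rightarrow> nat \<Rightarrow> nat" where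
  "cartan_character A k =
     (let b = (SOME b. generic_basis A b) in
        cmat.dim (tableau_kernel A b (k - 1)) - cmat.dim (tableau_kernel A b k))"

subsection \<open>Cartan's test\<close>

definition structure_equation ::
  "('s \<Rightarrow> 'c one_form) \<Rightarrow> ('n::finite \<Rightarrow> 'c covector) \<Rightarrow> ('r::finite \<Rightarrow> 'c covector) \<Rightarrow> complex^'c::finite
     \<Rightarrow> ('s \<Rightarrow> 'r \<Rightarrow> 'n \<Rightarrow> complex) \<Rightarrow> ('s \<Rightarrow> 'n \<Rightarrow> 'n \<Rightarrow> complex) \<Rightarrow> bool" where
  "structure_equation \<theta> \<omega> \<pi> p A T \<longleftrightarrow>
     (\<forall>\<alpha>. ext_deriv (\<theta> \<alpha>) p
            - (\<Sum>\<epsilon>\<in>UNIV. \<Sum>i\<in>UNIV. mscale (A \<alpha> \<epsilon> i) (wedge (\<pi> \<epsilon>) (\<omega> i)))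
            - (\<Sum>i\<in>UNIV. \<Sum>j\<in>UNIV. mscale (T \<alpha> i j) (wedge (\<omega> i) (\<omega> j)))
          \<in> ideal2 (fibre \<theta> p))"

text \<open>
  Matrices \<open>N = (N\<^sup>c\<^sub>i)\<close> such that the replacement \<open>\<pi>\<^sup>c \<mapsto> \<pi>\<^sup>c + N\<^sup>c\<^sub>i \<omega>\<^sup>i\<close> preserves the structure
  equations.
\<close>

definition prolongation_parameters ::
  "('s \<Rightarrow> 'c one_form) \<Rightarrow> ('n::finite \<Rightarrow> 'c one_form) \<Rightarrow> ('r::finite \<Rightarrow> 'c one_form) \<Rightarrow> complex^'c::finite
     \<Rightarrow> (complex^'n^'r) set" where
  "prolongation_parameters \<theta> \<omega> \<pi> p =
     {N. \<exists>A T. structure_equation \<theta> (\<lambda>i. \<omega> i p) (\<lambda>c. \<pi> c p) p A T \<and>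
          structure_equation \<theta> (\<lambda>i. \<omega> i p) (\<lambda>c. \<pi> c p + (\<Sum>i\<in>UNIV. N$c$i *s \<omega> i p)) p A T}"

definition involutive_tableau ::
  "('s::finite \<Rightarrow> 'c one_form) \<Rightarrow> (complex^'c::finite \<Rightarrow> 'c covector set)
     \<Rightarrow> ('n::finite \<Rightarrow> 'c one_form) \<Rightarrow> ('r::finite \<Rightarrow> 'c one_form) \<Rightarrow> complex^'c \<Rightarrow> bool" where
  "involutive_tableau \<theta> J \<omega> \<pi> p \<longleftrightarrow>
     (\<Sum>k=1..CARD('n). k * cartan_character (tableau \<theta> J \<omega> p) k)
       = cmat.dim (prolongation_parameters \<theta> \<omega> \<pi> p)"

section \<open>The system of the flat contact structure\<close>

text \<open>
  Coordinates \<open>(x\<^sup>i, u, u\<^sub>i, t\<^sup>a)\<close>.  The index \<open>i \<in> {0, \<dots>, n-1}\<close> is an element of \<open>'b option\<close>, with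
  \<open>None\<close> for \<open>0\<close> and \<open>Some a\<close> for \<open>a \<in> {1, \<dots>, n-1}\<close>; thus \<open>n = 1 + CARD('b)\<close>.
\<close>

datatype 'b coord = X "'b option" | U | P "'b option" | T 'b

lemma UNIV_coord: "UNIV = range X \<union> {U} \<union> range P \<union> range T"
proof (intro set_eqI iffI)
  fix x :: "'b coord"
  show "x \<in> range X \<union> {U} \<union> range P \<union> range T" by (cases x) auto
qed simp

instance coord :: (finite) finite
  by standard (simp add: UNIV_coord)

definition tpart :: "complex^'b coord \<Rightarrow> complex^'b::finite" where
  "tpart p = (\<chi> a. p $ T a)"

definition sigma :: "('b::finite) coord one_form" where
  "sigma p = dcoord U - (\<Sum>i\<in>UNIV. p$P i *s dcoord (X i))"

definition theta0 :: "('b::finite \<Rightarrow> 'b \<Rightarrow> 'b \<Rightarrow> complex) \<Rightarrow> 'b coord one_form" where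
  "theta0 C p = dcoord (P None) - cubic C (tpart p) *s dcoord (X None)
     - (\<Sum>a\<in>UNIV. (3/2 * cubic1 C a (tpart p)) *s dcoord (X (Some a)))"

definition theta :: "('b::finite \<Rightarrow> 'b \<Rightarrow> 'b \<Rightarrow> complex) \<Rightarrow> 'b \<Rightarrow> 'b coord one_form" where
  "theta C a p = dcoord (P (Some a)) - (3/2 * cubic1 C a (tpart p)) *s dcoord (X None)
     - (\<Sum>b\<in>UNIV. (3 * cubic2 C a b (tpart p)) *s dcoord (X (Some b)))"

text \<open>The generators \<open>\<sigma>, \<theta>\<^sub>0, \<dots>, \<theta>\<^sub>n\<^sub>-\<^sub>1\<close> of \<open>I\<close>, with \<open>None\<close> standing for \<open>\<sigma>\<close>.\<close>

definition I_forms :: "('b::finite \<Rightarrow> 'b \<Rightarrow> 'b \<Rightarrow> complex) \<Rightarrow> 'b option option \<Rightarrow> 'b coord one_form" where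
  "I_forms C \<alpha> =
     (case \<alpha> of None \<Rightarrow> sigma | Some None \<Rightarrow> theta0 C | Some (Some a) \<Rightarrow> theta C a)"

definition J_fibre :: "('b::finite \<Rightarrow> 'b \<Rightarrow> 'b \<Rightarrow> complex) \<Rightarrow> complex^'b coord \<Rightarrow> 'b coord covector set" where
  "J_fibre C p = vec.span (range (\<lambda>\<alpha>. I_forms C \<alpha> p) \<union> range (\<lambda>i. dcoord (X i)))"

definition omega :: "('b::finite) option \<Rightarrow> 'b coord one_form" where
  "omega i p = (case i of
       None \<Rightarrow> dcoord (X None)
     | Some b \<Rightarrow> 3 *s (dcoord (X (Some b)) + p$T b *s dcoord (X None)))"

definition dt :: "'b \<Rightarrow> ('b::finite) coord one_form" where
  "dt c p = dcoord (T c)"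

lemma card_coord: "CARD('b::finite coord) = 3 * CARD('b) + 3"
proof -
  have "CARD('b coord) = card (range (X :: 'b option \<Rightarrow> 'b coord) \<union> {U} \<union> range P \<union> range T)"
    by (simp only: UNIV_coord)
  also have "\<dots> = card (range (X :: 'b option \<Rightarrow> 'b coord)) + 1
      + card (range (P :: 'b option \<Rightarrow> 'b coord)) + card (range (T :: 'b \<Rightarrow> 'b coord))"
    by (subst card_Un_disjoint, simp, simp, blast)+ simp
  also have "\<dots> = 3 * CARD('b) + 3"
    by (simp add: card_image inj_def card_UNIV_option)
  finally show ?thesis .
qed

lemma adapted_coframe_omega_dt:
  fixes C :: "'b::finite \<Rightarrow> 'b \<Rightarrow> 'b \<Rightarrow> complex"
  shows "adapted_coframe (I_forms C) (J_fibre C) omega dt"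
  unfolding adapted_coframe_def Let_def
proof (intro allI conjI)
  fix p :: "complex^'b coord"
  let ?I = "range (\<lambda>\<alpha>. I_forms C \<alpha> p)" and ?w = "range (\<lambda>i. omega i p)"
    and ?x = "range (\<lambda>i. dcoord (X i)) :: 'b coord covector set"
  let ?e = "case_sum (\<lambda>\<alpha>. I_forms C \<alpha> p) (case_sum (\<lambda>i. omega i p) (\<lambda>c. dt c p))"
  define e where "e = ?e"
  have range_e: "range e = ?I \<union> (?w \<union> range (\<lambda>c. dt c p))"
    by (simp only: e_def UNIV_sum image_Un image_image sum.case)
  have w_x: "omega i p \<in> vec.span (?I \<union> ?x)" for i
    by (cases i)
      (auto simp: omega_def intro!: vec.span_scale vec.span_add intro: vec.span_base)
  have x0: "dcoord (X None) \<in> vec.span (?I \<union> ?w)"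
  proof -
    have "omega None p = dcoord (X None)" by (simp add: omega_def)
    then show ?thesis by (metis UnI2 rangeI vec.span_base)
  qed
  have x_w: "dcoord (X i) \<in> vec.span (?I \<union> ?w)" for i
  proof (cases i)
    case None
    then show ?thesis using x0 by simp
  next
    case (Some b)
    have "dcoord (X (Some b)) = (1/3) *s omega (Some b) p - p$T b *s dcoord (X None)"
      by (simp add: omega_def vec_eq_iff)
    also have "\<dots> \<in> vec.span (?I \<union> ?w)"
      by (intro vec.span_diff vec.span_scale x0 vec.span_base) auto
    finally show ?thesis using Some by simp
  qed
  show J: "vec.span (?I \<union> ?w) = J_fibre C p"
    unfolding J_fibre_def
  proof (rule vec.span_eq[THEN iffD2], intro conjI subsetI)
    show "v \<in> vec.span (?I \<union> ?x)" if "v \<in> ?I \<union> ?w" for v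
      using that w_x by (auto intro: vec.span_base)
    show "v \<in> vec.span (?I \<union> ?w)" if "v \<in> ?I \<union> ?x" for v
      using that x_w by (auto intro: vec.span_base)
  qed
  have sub: "vec.span (?I \<union> ?w) \<subseteq> vec.span (range e)"
    unfolding range_e by (rule vec.span_mono) auto
  have X_in: "dcoord (X i) \<in> vec.span (range e)" for i
    using x_w sub by blast
  have I_in: "I_forms C \<alpha> p \<in> vec.span (range e)" for \<alpha>
    by (rule vec.span_base) (simp add: range_e)
  have T_in: "dcoord (T c) \<in> vec.span (range e)" for c
  proof -
    have "dt c p \<in> vec.span (range e)" by (rule vec.span_base) (simp add: range_e)
    then show ?thesis by (simp add: dt_def)
  qed
  have "dcoord U = I_forms C None p + (\<Sum>i\<in>UNIV. p$P i *s dcoord (X i))"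
    by (simp add: I_forms_def sigma_def)
  then have U_in: "dcoord U \<in> vec.span (range e)"
    by (simp only:) (intro vec.span_add vec.span_sum vec.span_scale I_in X_in)
  have P_in: "dcoord (P i) \<in> vec.span (range e)" for i
  proof (cases i)
    case None
    have "dcoord (P None) = I_forms C (Some None) p + cubic C (tpart p) *s dcoord (X None)
        + (\<Sum>a\<in>UNIV. (3/2 * cubic1 C a (tpart p)) *s dcoord (X (Some a)))"
      by (simp add: I_forms_def theta0_def)
    then show ?thesis
      unfolding None by (simp only:) (intro vec.span_add vec.span_sum vec.span_scale I_in X_in)
  next
    case (Some a)
    have "dcoord (P (Some a)) = I_forms C (Some (Some a)) p
        + (3/2 * cubic1 C a (tpart p)) *s dcoord (X None)
        + (\<Sum>b\<in>UNIV. (3 * cubic2 C a b (tpart p)) *s dcoord (X (Some b)))"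
      by (simp add: I_forms_def theta_def)
    then show ?thesis
      unfolding Some by (simp only:) (intro vec.span_add vec.span_sum vec.span_scale I_in X_in)
  qed
  have coord_in: "dcoord \<mu> \<in> vec.span (range e)" for \<mu> :: "'b coord"
    by (cases \<mu>) (simp_all add: X_in U_in P_in T_in)
  have "v \<in> vec.span (range e)" for v
  proof -
    have "v = (\<Sum>\<mu>\<in>UNIV. v$\<mu> *s dcoord \<mu>)"
      unfolding dcoord_def by (simp add: basis_expansion)
    then show ?thesis
      by (metis (no_types, lifting) coord_in vec.span_scale vec.span_sum)
  qed
  then have span_e: "vec.span (range e) = UNIV" by auto
  have card_index: "CARD('b option option + 'b option + 'b) = CARD('b coord)"
    by (simp add: card_coord card_UNIV_option)
  have dim: "vec.dim (UNIV :: 'b coord covector set) = CARD('b coord)"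
    by (simp add: vec.dim_UNIV card_cart_basis)
  have "CARD('b coord) \<le> card (range e)"
    unfolding dim[symmetric] by (rule vec.dim_le_card) (simp_all add: span_e)
  moreover have "card (range e) \<le> CARD('b option option + 'b option + 'b)"
    by (rule card_image_le) simp
  ultimately have card_e: "card (range e) = CARD('b option option + 'b option + 'b)"
    using card_index by linarith
  show "inj ?e"
    unfolding e_def[symmetric] using card_e by (intro eq_card_imp_inj_on) auto
  show "vec.independent (range ?e)"
    unfolding e_def[symmetric] using card_e card_index span_e dim
    by (intro vec.card_le_dim_spanning[of _ UNIV]) auto
  show "vec.span (range ?e) = UNIV"
    using span_e unfolding e_def .
qed

end

theory Submission
  imports Defs
begin

text \<open>
  Write \<open>C(x, y, z)\<close> for the symmetric trilinear form with \<open>C(t, t, t) = \<CC>(t\<^sup>3)\<close>.  The structure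
  equations (\<open>structure_equation_system\<close>) say that, at every point, the tableau is
  \<open>{C(\<cdot>, \<cdot>, v) | v \<in> W}\<close> and that the prolongation consists of the endomorphisms \<open>N\<close> of \<open>W\<close> for
  which \<open>C(x, y, N z)\<close> is symmetric in \<open>y\<close> and \<open>z\<close>, hence in all three arguments; they are called
  multipliers below.  The component of a prolongation parameter along \<open>\<omega>\<^sup>0\<close> vanishes when \<open>C\<close> is
  nondegenerate.

  In all cases there is an \<open>e \<in> W\<close> with \<open>C(e, \<cdot>, \<cdot>)\<close> nondegenerate.  A basis whose first vector lies
  over \<open>e\<close> is then generic and already its first vector annihilates no nonzero element of the
  tableau, so that \<open>s\<^sub>1 = dim W\<close> and all further characters are zero
  (\<open>cartan_character_system\<close>).  Cartan's test becomes \<open>r\<^sup>(\<^sup>1\<^sup>) = dim W\<close>.  A multiplier \<open>N\<close> is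
  determined by \<open>N e\<close>, because \<open>C(e, N x, z) = C(N e, x, z)\<close>.  Hence the tableau is involutive iff
  every element of \<open>W\<close> is \<open>N e\<close> for some multiplier \<open>N\<close> (\<open>involutive_system_iff\<close>).

  This condition fails as soon as there are \<open>a\<close> and \<open>b \<noteq> 0\<close> in \<open>W\<close> with \<open>C(a, a, \<cdot>) = 0\<close> and
  \<open>C(a, b, \<cdot>) = C(e, b, \<cdot>)\<close> (\<open>not_involutive_criterion\<close>).  Indeed \<open>N e = a\<close> would give
  \<open>C(e, N\<^sup>2 e, \<cdot>) = C(a, a, \<cdot>) = 0\<close> and \<open>C(e, N b, \<cdot>) = C(a, b, \<cdot>) = C(e, b, \<cdot>)\<close>, that is,
  \<open>N\<^sup>2 e = 0\<close> and \<open>N b = b\<close>, whence \<open>C(e, b, \<cdot>) = C(e, N\<^sup>2 b, \<cdot>) = C(N\<^sup>2 e, b, \<cdot>) = 0\<close>.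

  For diagonal and for Hermitian matrices let \<open>e\<close> be the identity matrix, \<open>a = E\<^sub>1\<close> and
  \<open>b = E\<^sub>2 - E\<^sub>3\<close>, where \<open>E\<^sub>i\<close> are the diagonal matrix units: each of them satisfies
  \<open>C(E\<^sub>i, E\<^sub>i, \<cdot>) = 0\<close>, so \<open>C(e - a, b, \<cdot>) = C(E\<^sub>2, E\<^sub>2, \<cdot>) - C(E\<^sub>3, E\<^sub>3, \<cdot>) = 0\<close>.  The determinant of a
  general octonionic Hermitian matrix is never computed.  Conjugation by a diagonal matrix of signs
  preserves it, which makes most values of the trilinear form vanish; the others come from matrices
  with a single pair of conjugate off-diagonal entries, where the Cayley-Hamilton identity only involves
  \<open>x x\<^sup>* = q(x) 1\<close>.  In a spin factor \<open>\<C>\<^sup>m \<oplus> \<C>\<close> with \<open>m \<ge> 2\<close> let \<open>e = (u, 1)\<close> with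
  \<open>\<langle>u, u\<rangle> \<noteq> 0\<close>, \<open>a = (0, 1)\<close> and \<open>b = (v, 0)\<close> with \<open>v \<noteq> 0\<close> orthogonal to \<open>u\<close>.

  There remain \<open>\<C>\<close> for \<open>G\<^sub>2\<close> and \<open>\<C>\<^sup>1 \<oplus> \<C>\<close> for \<open>B\<^sub>3\<close>.  Their multipliers form the algebras \<open>\<C>\<close> and
  \<open>\<C>[\<epsilon>]/(\<epsilon>\<^sup>2)\<close>, of the same dimension as \<open>W\<close>, and \<open>s\<^sub>1 = dim W\<close> is 1 and 2.
\<close>

section \<open>Dimension under injective linear maps\<close>

text \<open>
  Used in both directions: from column vectors to matrices for the tableau, and from matrices to
  column vectors for the prolongation.
\<close>

lemma (in vector_space_pair) dim_injective_linear_image: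
  assumes f: "Vector_Spaces.linear s1 s2 f" and inj: "inj_on f (vs1.span S)"
  shows "vs2.dim (f ` S) = vs1.dim S"
proof -
  obtain B where B: "B \<subseteq> S" "vs1.independent B" "S \<subseteq> vs1.span B" "card B = vs1.dim S"
    using vs1.basis_exists[of S] by auto
  have span: "vs1.span B = vs1.span S"
    using B vs1.span_mono[of B S] vs1.span_mono[of S "vs1.span B"] vs1.span_span[of B] by auto
  have "vs2.independent (f ` B)"
    using linear_independent_injective_image[OF f B(2)] inj span by simp
  moreover have "vs2.span (f ` B) = vs2.span (f ` S)"
    by (simp add: linear_span_image[OF f] span)
  ultimately have "vs2.dim (f ` S) = card (f ` B)"
    by (rule vs2.dim_eq_card[rotated])
  also have "\<dots> = card B"
    using inj B(1) vs1.span_superset by (intro card_image) (blast intro: inj_on_subset)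
  finally show ?thesis using B(4) by simp
qed

interpretation vec_cmat: vector_space_pair
  "(*s) :: complex \<Rightarrow> complex^'k \<Rightarrow> complex^'k"
  "mscale :: complex \<Rightarrow> complex^'n^'m \<Rightarrow> complex^'n^'m"
  by unfold_locales

interpretation cmat_vec: vector_space_pair
  "mscale :: complex \<Rightarrow> complex^'n^'m \<Rightarrow> complex^'n^'m"
  "(*s) :: complex \<Rightarrow> complex^'k \<Rightarrow> complex^'k"
  by unfold_locales

section \<open>Tableau and prolongation from the structure equations\<close>

lemma pairing_linear:
  "pairing (\<alpha> + \<beta>) v = pairing \<alpha> v + pairing \<beta> v"
  "pairing (\<alpha> - \<beta>) v = pairing \<alpha> v - pairing \<beta> v"
  "pairing (c *s \<alpha>) v = c * pairing \<alpha> v"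
  "pairing 0 v = 0"
  "pairing (sum g S) v = (\<Sum>i\<in>S. pairing (g i) v)"
proof -
  show "pairing (sum g S) v = (\<Sum>i\<in>S. pairing (g i) v)"
    unfolding pairing_def
    by (subst sum.swap) (simp add: sum_distrib_right)
qed (simp_all add: pairing_def algebra_simps sum.distrib sum_subtractf sum_distrib_left)

lemma interior_product_linear:
  "interior_product v (A + B) = interior_product v A + interior_product v B"
  "interior_product v (A - B) = interior_product v A - interior_product v B"
  "interior_product v (mscale c A) = c *s interior_product v A"
  "interior_product v 0 = 0"
  "interior_product v (sum g S) = (\<Sum>i\<in>S. interior_product v (g i))"
proof -
  show "interior_product v (sum g S) = (\<Sum>i\<in>S. interior_product v (g i))"
    unfolding interior_product_def vec_eq_iff
    by (simp add: sum_distrib_left) (subst sum.swap, simp)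
qed (simp_all add: interior_product_def mscale_def vec_eq_iff algebra_simps sum.distrib
    sum_subtractf sum_distrib_left)

lemma interior_product_wedge:
  "interior_product v (wedge \<alpha> \<beta>) = pairing \<alpha> v *s \<beta> - pairing \<beta> v *s \<alpha>"
  by (simp add: interior_product_def wedge_def pairing_def vec_eq_iff algebra_simps
      sum_subtractf sum_distrib_left)

lemma wedge_linear:
  "wedge (\<alpha> + \<beta>) \<gamma> = wedge \<alpha> \<gamma> + wedge \<beta> \<gamma>"
  "wedge \<gamma> (\<alpha> + \<beta>) = wedge \<gamma> \<alpha> + wedge \<gamma> \<beta>"
  "wedge (\<alpha> - \<beta>) \<gamma> = wedge \<alpha> \<gamma> - wedge \<beta> \<gamma>"
  "wedge \<gamma> (\<alpha> - \<beta>) = wedge \<gamma> \<alpha> - wedge \<gamma> \<beta>"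
  "wedge (c *s \<alpha>) \<gamma> = mscale c (wedge \<alpha> \<gamma>)"
  "wedge \<gamma> (c *s \<alpha>) = mscale c (wedge \<gamma> \<alpha>)"
  "wedge (sum g S) \<gamma> = (\<Sum>i\<in>S. wedge (g i) \<gamma>)"
  "wedge \<gamma> (sum g S) = (\<Sum>i\<in>S. wedge \<gamma> (g i))"
proof -
  show "wedge (sum g S) \<gamma> = (\<Sum>i\<in>S. wedge (g i) \<gamma>)"
    by (simp add: wedge_def vec_eq_iff sum_distrib_left sum_distrib_right sum_subtractf)
  show "wedge \<gamma> (sum g S) = (\<Sum>i\<in>S. wedge \<gamma> (g i))"
    by (simp add: wedge_def vec_eq_iff sum_distrib_left sum_distrib_right sum_subtractf)
qed (simp_all add: wedge_def mscale_def vec_eq_iff algebra_simps)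

lemma wedge_anticommute: "wedge \<alpha> \<beta> = - wedge \<beta> \<alpha>"
  by (simp add: wedge_def vec_eq_iff)

text \<open>
  A change of the \<open>\<pi>\<^sup>c\<close> by multiples of the \<open>\<omega>\<^sup>i\<close> preserves the structure equations through this
  cancellation.
\<close>

lemma wedge_symmetric_sum:
  fixes S :: "'n::finite \<Rightarrow> 'n \<Rightarrow> complex" and \<omega> :: "'n \<Rightarrow> 'c::finite covector"
  assumes "\<And>i j. S i j = S j i"
  shows "(\<Sum>i\<in>UNIV. \<Sum>j\<in>UNIV. mscale (S i j) (wedge (\<omega> j) (\<omega> i))) = 0"
proof -
  let ?s = "\<Sum>i\<in>UNIV. \<Sum>j\<in>UNIV. mscale (S i j) (wedge (\<omega> j) (\<omega> i))"
  have "?s = (\<Sum>i\<in>UNIV. \<Sum>j\<in>UNIV. mscale (S j i) (wedge (\<omega> i) (\<omega> j)))"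
    by (rule sum.swap)
  also have "\<dots> = - ?s"
    unfolding sum_negf[symmetric]
    by (intro sum.cong refl) (subst assms, subst wedge_anticommute, simp only:
        cmat.scale_minus_right)
  finally have "?s = - ?s" .
  moreover have "x = 0" if "x = - x" for x :: "'c two_covector"
  proof -
    have "x$i$j = - x$i$j" for i j by (subst that) simp
    then have "x$i$j = 0" for i j by (simp add: eq_neg_iff_add_eq_0)
    then show ?thesis by (simp add: vec_eq_iff)
  qed
  ultimately show ?thesis by blast
qed

lemma pairing_span_eq_0:
  assumes "\<And>\<alpha>. \<alpha> \<in> S \<Longrightarrow> pairing \<alpha> v = 0" and "\<beta> \<in> vec.span S"
  shows "pairing \<beta> v = 0"
proof -
  have "vec.subspace {\<beta>. pairing \<beta> v = 0}"
    by (simp add: vec.subspace_def pairing_linear)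
  then have "vec.span S \<subseteq> {\<beta>. pairing \<beta> v = 0}"
    using assms(1) by (intro vec.span_minimal) auto
  then show ?thesis using assms(2) by auto
qed

text \<open>
  Consequently a 2-form in the ideal generated by \<open>I\<close> is zero on pairs of vectors annihilated by
  \<open>I\<close>; coefficients of 2-forms modulo \<open>I\<close> are compared by evaluation on such pairs.
\<close>

lemma interior_product_ideal2:
  assumes \<Omega>: "\<Omega> \<in> ideal2 S" and v: "\<And>\<alpha>. \<alpha> \<in> S \<Longrightarrow> pairing \<alpha> v = 0"
  shows "interior_product v \<Omega> \<in> vec.span S"
proof -
  let ?V = "{\<Omega>. interior_product v \<Omega> \<in> vec.span S}"
  have "cmat.subspace ?V"
    by (auto simp: cmat.subspace_def interior_product_linear vec.span_zero
        intro: vec.span_add vec.span_scale)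
  moreover have "{wedge \<alpha> \<beta> |\<alpha> \<beta>. \<alpha> \<in> S} \<subseteq> ?V"
    using v by (auto simp: interior_product_wedge intro!: vec.span_neg[OF vec.span_scale[OF
        vec.span_base]])
  ultimately have "ideal2 S \<subseteq> ?V"
    unfolding ideal2_def by (intro cmat.span_minimal)
  then show ?thesis using \<Omega> by auto
qed

lemma pairing_fibre_eq_0:
  assumes "\<And>\<alpha>. pairing (\<theta> \<alpha> p) v = 0" and "\<beta> \<in> fibre \<theta> p"
  shows "pairing \<beta> v = 0"
proof (rule pairing_span_eq_0)
  show "\<beta> \<in> vec.span (range (\<lambda>\<alpha>. \<theta> \<alpha> p))" using assms(2) by (simp only: fibre_def)
qed (use assms(1) in auto)

lemma interior_product_ideal2_fibre:
  assumes "\<Omega> \<in> ideal2 (fibre \<theta> p)" and "\<And>\<alpha>. pairing (\<theta> \<alpha> p) v = 0"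
  shows "interior_product v \<Omega> \<in> fibre \<theta> p"
proof -
  have "interior_product v \<Omega> \<in> vec.span (fibre \<theta> p)"
    by (rule interior_product_ideal2[OF assms(1)]) (rule pairing_fibre_eq_0[where \<theta>=\<theta>, OF assms(2)])
  then show ?thesis by (simp only: fibre_def vec.span_span)
qed

lemma ideal2_eval_eq_0:
  assumes "\<Omega> \<in> ideal2 (fibre \<theta> p)"
    and "\<And>\<alpha>. pairing (\<theta> \<alpha> p) u = 0" and "\<And>\<alpha>. pairing (\<theta> \<alpha> p) v = 0"
  shows "pairing (interior_product u \<Omega>) v = 0"
  by (rule pairing_fibre_eq_0[where \<theta>=\<theta>, OF assms(3) interior_product_ideal2_fibre[OF assms(1,2)]])

text \<open>
  The coframe is a basis of the covectors, so its values on a tangent vector can be prescribed.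
\<close>

lemma adapted_coframe_dual_vector:
  fixes \<theta> :: "'s \<Rightarrow> 'c::finite one_form"
  assumes "adapted_coframe \<theta> J \<omega> \<pi>"
  obtains v where "\<And>\<alpha>. pairing (\<theta> \<alpha> p) v = f \<alpha>" "\<And>i. pairing (\<omega> i p) v = g i"
    "\<And>c. pairing (\<pi> c p) v = h c"
proof -
  define e where "e = case_sum (\<lambda>\<alpha>. \<theta> \<alpha> p) (case_sum (\<lambda>i. \<omega> i p) (\<lambda>c. \<pi> c p))"
  define val where "val = case_sum f (case_sum g h)"
  have e: "inj e" "vec.independent (range e)"
    using assms unfolding adapted_coframe_def Let_def e_def by auto
  interpret vs: vector_space_pair "(*s) :: complex \<Rightarrow> complex^'c::finite \<Rightarrow> complex^'c" "(*) ::
      complex \<Rightarrow> complex \<Rightarrow> complex"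
    by unfold_locales
  obtain G where G: "Vector_Spaces.linear (*s) (*) G" and Ge: "\<And>x. x \<in> range e \<Longrightarrow> G x = val (inv
      e x)"
    using vs.linear_independent_extend[OF e(2), of "\<lambda>x. val (inv e x)"] by blast
  define v where "v = (\<chi> \<mu>. G (dcoord \<mu>))"
  have "pairing \<beta> v = G \<beta>" for \<beta>
  proof -
    have "G \<beta> = G (\<Sum>\<mu>\<in>UNIV. \<beta>$\<mu> *s dcoord \<mu>)"
      by (simp add: dcoord_def basis_expansion)
    also have "\<dots> = pairing \<beta> v"
      using G by (simp add: pairing_def v_def vs.linear_sum vs.linear_scale)
    finally show ?thesis by simp
  qed
  then have "pairing (e k) v = val k" for k
    using Ge e(1) by simp
  from this[of "Inl _"] this[of "Inr (Inl _)"] this[of "Inr (Inr _)"] show thesis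
    by (intro that) (simp_all add: e_def val_def)
qed

lemma adapted_coframe_tangent_vectors:
  fixes \<theta> :: "'s \<Rightarrow> 'c::finite one_form"
  assumes "adapted_coframe \<theta> J \<omega> \<pi>"
  shows "\<exists>v. (\<forall>\<alpha>. pairing (\<theta> \<alpha> p) v = 0) \<and> (\<forall>i. pairing (\<omega> i p) v = g i) \<and> (\<forall>c. pairing (\<pi> c p)
      v = h c)"
  by (rule adapted_coframe_dual_vector[OF assms, of p "\<lambda>_. 0" g h]) blast

lemma sum_delta_mult:
  fixes f :: "'n::finite \<Rightarrow> complex"
  shows "(\<Sum>i\<in>UNIV. f i * (if i = k then 1 else 0)) = f k"
    and "(\<Sum>i\<in>UNIV. f i * ((if i = k then 1 else 0) * c)) = f k * c"
proof -
  show *: "(\<Sum>i\<in>UNIV. f i * (if i = k then 1 else 0)) = f k" for f :: "'n \<Rightarrow> complex"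
    by (simp add: if_distrib[of "(*) _"] sum.delta cong: if_cong)
  show "(\<Sum>i\<in>UNIV. f i * ((if i = k then 1 else 0) * c)) = f k * c"
    using *[of "\<lambda>i. f i * c"] by (simp add: ac_simps)
qed

lemma structure_equation_interior:
  fixes \<theta> :: "'s \<Rightarrow> 'c::finite one_form"
    and \<omega> :: "'n::finite \<Rightarrow> 'c one_form" and \<pi> :: "'r::finite \<Rightarrow> 'c one_form"
  assumes se: "structure_equation \<theta> (\<lambda>i. \<omega> i p) (\<lambda>c. \<pi> c p) p A \<tau>"
    and "\<And>\<alpha>. pairing (\<theta> \<alpha> p) v = 0" "\<And>i. pairing (\<omega> i p) v = 0"
  shows "interior_product v (ext_deriv (\<theta> \<alpha>) p)
      - (\<Sum>i\<in>UNIV. (\<Sum>\<epsilon>\<in>UNIV. A \<alpha> \<epsilon> i * pairing (\<pi> \<epsilon> p) v) *s \<omega> i p) \<in> fibre \<theta> p"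
proof -
  have "(\<Sum>i\<in>UNIV. (\<Sum>\<epsilon>\<in>UNIV. A \<alpha> \<epsilon> i * pairing (\<pi> \<epsilon> p) v) *s \<omega> i p)
      = (\<Sum>\<epsilon>\<in>UNIV. \<Sum>i\<in>UNIV. (A \<alpha> \<epsilon> i * pairing (\<pi> \<epsilon> p) v) *s \<omega> i p)"
    by (subst sum.swap) (simp add: vec.scale_sum_left)
  then show ?thesis
    using interior_product_ideal2_fibre[OF se[unfolded structure_equation_def, rule_format, of
        \<alpha>] assms(2)] assms(3)
    by (simp add: interior_product_linear interior_product_wedge)
qed

text \<open>
  Inserting a vector annihilated by \<open>J\<close> leaves only the terms \<open>A \<pi> \<and> \<omega>\<close>, and the \<open>\<omega>\<^sup>i\<close> are independent
  modulo \<open>I\<close>.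
\<close>

theorem tableau_eq:
  fixes \<theta> :: "'s::finite \<Rightarrow> 'c::finite one_form"
    and \<omega> :: "'n::finite \<Rightarrow> 'c one_form" and \<pi> :: "'r::finite \<Rightarrow> 'c one_form"
  assumes frame: "adapted_coframe \<theta> J \<omega> \<pi>"
    and se: "structure_equation \<theta> (\<lambda>i. \<omega> i p) (\<lambda>c. \<pi> c p) p A \<tau>"
  shows "tableau \<theta> J \<omega> p = range (\<lambda>w. \<chi> \<alpha> i. \<Sum>\<epsilon>\<in>UNIV. A \<alpha> \<epsilon> i * w \<epsilon>)"
proof -
  have J: "J p = vec.span (range (\<lambda>\<alpha>. \<theta> \<alpha> p) \<union> range (\<lambda>i. \<omega> i p))"
    using frame unfolding adapted_coframe_def Let_def by metis
  have annJ: "(\<forall>\<beta>\<in>J p. pairing \<beta> v = 0) \<longleftrightarrow>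
      (\<forall>\<alpha>. pairing (\<theta> \<alpha> p) v = 0) \<and> (\<forall>i. pairing (\<omega> i p) v = 0)" (is "?L \<longleftrightarrow> ?R") for v
  proof
    assume ?L
    moreover have "\<theta> \<alpha> p \<in> J p" "\<omega> i p \<in> J p" for \<alpha> i
      unfolding J by (rule vec.span_base, simp)+
    ultimately show ?R by blast
  next
    assume ?R
    show ?L
    proof
      fix \<beta> assume "\<beta> \<in> J p"
      then show "pairing \<beta> v = 0"
        unfolding J by (rule pairing_span_eq_0[rotated]) (use \<open>?R\<close> in auto)
    qed
  qed
  have "M = (\<chi> \<alpha> i. \<Sum>\<epsilon>\<in>UNIV. A \<alpha> \<epsilon> i * pairing (\<pi> \<epsilon> p) v)"
    if ann: "\<forall>\<alpha>. pairing (\<theta> \<alpha> p) v = 0" "\<forall>i. pairing (\<omega> i p) v = 0"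
      and M: "\<forall>\<alpha>. interior_product v (ext_deriv (\<theta> \<alpha>) p) - (\<Sum>i\<in>UNIV. M$\<alpha>$i *s \<omega> i p) \<in> fibre \<theta> p"
    for M v
  proof -
    have "M$\<alpha>$k = (\<Sum>\<epsilon>\<in>UNIV. A \<alpha> \<epsilon> k * pairing (\<pi> \<epsilon> p) v)" for \<alpha> k
    proof -
      obtain D where D: "\<And>\<alpha>. pairing (\<theta> \<alpha> p) D = 0" "\<And>i. pairing (\<omega> i p) D = (if i = k then 1
          else 0)"
        using adapted_coframe_tangent_vectors[OF frame, of p "\<lambda>i. if i = k then 1 else 0" "\<lambda>_.
            0"] by metis
      have fib: "pairing \<beta> D = 0" if "\<beta> \<in> fibre \<theta> p" for \<beta>
        using that D(1) by (rule pairing_fibre_eq_0[rotated])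
      have "pairing (interior_product v (ext_deriv (\<theta> \<alpha>) p)) D = M$\<alpha>$k"
        using fib[OF M[rule_format, of \<alpha>]] by (simp add: pairing_linear D(2) sum_delta_mult)
      moreover have "pairing (interior_product v (ext_deriv (\<theta> \<alpha>) p)) D
          = (\<Sum>\<epsilon>\<in>UNIV. A \<alpha> \<epsilon> k * pairing (\<pi> \<epsilon> p) v)"
        using fib[OF structure_equation_interior[where \<omega>=\<omega> and \<pi>=\<pi>, OF se, of v]] ann by (simp
            add: pairing_linear D(2) sum_delta_mult)
      ultimately show ?thesis by simp
    qed
    then show ?thesis by (simp add: vec_eq_iff)
  qed
  note tableau_matrix = this
  have "\<exists>v. (\<forall>\<beta>\<in>J p. pairing \<beta> v = 0) \<and>
      (\<forall>\<alpha>. interior_product v (ext_deriv (\<theta> \<alpha>) p)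
         - (\<Sum>i\<in>UNIV. (\<chi> \<alpha> i. \<Sum>\<epsilon>\<in>UNIV. A \<alpha> \<epsilon> i * w \<epsilon>)$\<alpha>$i *s \<omega> i p) \<in> fibre \<theta> p)" for w
  proof -
    obtain v where v: "\<And>\<alpha>. pairing (\<theta> \<alpha> p) v = 0" "\<And>i. pairing (\<omega> i p) v = 0" "\<And>c. pairing (\<pi> c
        p) v = w c"
      using adapted_coframe_tangent_vectors[OF frame, of p "\<lambda>_. 0" w] by metis
    have "\<forall>\<beta>\<in>J p. pairing \<beta> v = 0"
      unfolding annJ using v by blast
    then show ?thesis
      using structure_equation_interior[where \<omega>=\<omega> and \<pi>=\<pi>, OF se v(1,2)]
      by (intro exI[of _ v]) (simp add: v(3))
  qed
  note tangent_vector = this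
  show ?thesis
    unfolding tableau_def
  proof (intro set_eqI iffI)
    fix M assume "M \<in> {M. \<exists>v. (\<forall>\<beta>\<in>J p. pairing \<beta> v = 0) \<and>
        (\<forall>\<alpha>. interior_product v (ext_deriv (\<theta> \<alpha>) p) - (\<Sum>i\<in>UNIV. M$\<alpha>$i *s \<omega> i p) \<in> fibre \<theta> p)}"
    then obtain v where "\<forall>\<alpha>. pairing (\<theta> \<alpha> p) v = 0" "\<forall>i. pairing (\<omega> i p) v = 0"
        "\<forall>\<alpha>. interior_product v (ext_deriv (\<theta> \<alpha>) p) - (\<Sum>i\<in>UNIV. M$\<alpha>$i *s \<omega> i p) \<in> fibre \<theta> p"
      unfolding annJ by (elim CollectE exE conjE)
    from tableau_matrix[OF this] show "M \<in> range (\<lambda>w. \<chi> \<alpha> i. \<Sum>\<epsilon>\<in>UNIV. A \<alpha> \<epsilon> i * w \<epsilon>)"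
      by (rule range_eqI[where x="\<lambda>\<epsilon>. pairing (\<pi> \<epsilon> p) v"])
  next
    fix M assume "M \<in> range (\<lambda>w. \<chi> \<alpha> i. \<Sum>\<epsilon>\<in>UNIV. A \<alpha> \<epsilon> i * w \<epsilon>)"
    then obtain w where M: "M = (\<chi> \<alpha> i. \<Sum>\<epsilon>\<in>UNIV. A \<alpha> \<epsilon> i * w \<epsilon>)" by (elim rangeE)
    show "M \<in> {M. \<exists>v. (\<forall>\<beta>\<in>J p. pairing \<beta> v = 0) \<and>
        (\<forall>\<alpha>. interior_product v (ext_deriv (\<theta> \<alpha>) p) - (\<Sum>i\<in>UNIV. M$\<alpha>$i *s \<omega> i p) \<in> fibre \<theta> p)}"
      unfolding M mem_Collect_eq by (rule tangent_vector)
  qed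
qed

lemma structure_equation_eval:
  fixes \<theta> :: "'s \<Rightarrow> 'c::finite one_form"
    and \<omega> :: "'n::finite \<Rightarrow> 'c covector" and \<pi> :: "'r::finite \<Rightarrow> 'c covector"
  assumes se: "structure_equation \<theta> \<omega> \<pi> p A \<tau>"
    and u: "\<And>\<alpha>. pairing (\<theta> \<alpha> p) u = 0" and v: "\<And>\<alpha>. pairing (\<theta> \<alpha> p) v = 0"
  shows "pairing (interior_product u (ext_deriv (\<theta> \<alpha>) p)) v =
    (\<Sum>\<epsilon>\<in>UNIV. \<Sum>i\<in>UNIV. A \<alpha> \<epsilon> i *
        (pairing (\<pi> \<epsilon>) u * pairing (\<omega> i) v - pairing (\<omega> i) u * pairing (\<pi> \<epsilon>) v))
    + (\<Sum>i\<in>UNIV. \<Sum>j\<in>UNIV. \<tau> \<alpha> i j *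
        (pairing (\<omega> i) u * pairing (\<omega> j) v - pairing (\<omega> j) u * pairing (\<omega> i) v))"
  using ideal2_eval_eq_0[OF se[unfolded structure_equation_def, rule_format, of \<alpha>] u v]
  by (simp add: interior_product_linear interior_product_wedge pairing_linear algebra_simps)

text \<open>
  The set of parameters is defined through some coefficients \<open>A'\<close> and \<open>\<tau>'\<close> for which both structure
  equations hold.  Evaluation on the vectors dual to \<open>\<pi>\<^sup>c\<close> and \<open>\<omega>\<^sup>i\<close> shows that \<open>A'\<close> is unique;
  evaluation on the vectors dual to \<open>\<omega>\<^sup>k\<close> and \<open>\<omega>\<^sup>l\<close> then eliminates \<open>\<tau>'\<close> from the difference of
  the two equations.
\<close>

theorem prolongation_parameters_eq:
  fixes \<theta> :: "'s \<Rightarrow> 'c::finite one_form"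
    and \<omega> :: "'n::finite \<Rightarrow> 'c one_form" and \<pi> :: "'r::finite \<Rightarrow> 'c one_form"
  assumes frame: "adapted_coframe \<theta> J \<omega> \<pi>"
    and se: "structure_equation \<theta> (\<lambda>i. \<omega> i p) (\<lambda>c. \<pi> c p) p A \<tau>"
  shows "prolongation_parameters \<theta> \<omega> \<pi> p =
    {N. \<forall>\<alpha> k l. (\<Sum>\<epsilon>\<in>UNIV. A \<alpha> \<epsilon> l * N$\<epsilon>$k) = (\<Sum>\<epsilon>\<in>UNIV. A \<alpha> \<epsilon> k * N$\<epsilon>$l)}"
proof (intro set_eqI iffI)
  fix N assume "N \<in> prolongation_parameters \<theta> \<omega> \<pi> p"
  then obtain A' \<tau>' where
    se1: "structure_equation \<theta> (\<lambda>i. \<omega> i p) (\<lambda>c. \<pi> c p) p A' \<tau>'" and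
    se2: "structure_equation \<theta> (\<lambda>i. \<omega> i p) (\<lambda>c. \<pi> c p + (\<Sum>i\<in>UNIV. N$c$i *s \<omega> i p)) p A' \<tau>'"
    unfolding prolongation_parameters_def by blast
  have A': "A' \<alpha> c i = A \<alpha> c i" for \<alpha> c i
  proof -
    obtain u where u: "\<And>\<alpha>. pairing (\<theta> \<alpha> p) u = 0" "\<And>i. pairing (\<omega> i p) u = 0"
        "\<And>c'. pairing (\<pi> c' p) u = (if c' = c then 1 else 0)"
      using adapted_coframe_tangent_vectors[OF frame, of p "\<lambda>_. 0" "\<lambda>c'. if c' = c then 1 else
          0"] by metis
    obtain v where v: "\<And>\<alpha>. pairing (\<theta> \<alpha> p) v = 0" "\<And>i'. pairing (\<omega> i' p) v = (if i' = i then 1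
        else 0)"
      using adapted_coframe_tangent_vectors[OF frame, of p "\<lambda>i'. if i' = i then 1 else 0" "\<lambda>_.
          0"] by metis
    show ?thesis
      using structure_equation_eval[OF se u(1) v(1), of \<alpha>] structure_equation_eval[OF se1 u(1)
          v(1), of \<alpha>]
      by (simp add: u v mult.assoc[symmetric] sum_delta_mult)
  qed
  show "N \<in> {N. \<forall>\<alpha> k l. (\<Sum>\<epsilon>\<in>UNIV. A \<alpha> \<epsilon> l * N$\<epsilon>$k) = (\<Sum>\<epsilon>\<in>UNIV. A \<alpha> \<epsilon> k * N$\<epsilon>$l)}"
  proof (intro CollectI allI)
    fix \<alpha> k l
    obtain u where u: "\<And>\<alpha>. pairing (\<theta> \<alpha> p) u = 0" "\<And>i. pairing (\<omega> i p) u = (if i = k then 1 else 0)"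
        "\<And>c. pairing (\<pi> c p) u = 0"
      using adapted_coframe_tangent_vectors[OF frame, of p "\<lambda>i. if i = k then 1 else 0" "\<lambda>_. 0"]
          by metis
    obtain v where v: "\<And>\<alpha>. pairing (\<theta> \<alpha> p) v = 0" "\<And>i. pairing (\<omega> i p) v = (if i = l then 1 else 0)"
        "\<And>c. pairing (\<pi> c p) v = 0"
      using adapted_coframe_tangent_vectors[OF frame, of p "\<lambda>i. if i = l then 1 else 0" "\<lambda>_. 0"]
          by metis
    have "(\<Sum>\<epsilon>\<in>UNIV. \<Sum>i\<in>UNIV. A \<alpha> \<epsilon> i *
        (N$\<epsilon>$k * (if i = l then 1 else 0) - (if i = k then 1 else 0) * N$\<epsilon>$l)) = 0"
      using structure_equation_eval[OF se1 u(1) v(1), of \<alpha>] structure_equation_eval[OF se2 u(1)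
          v(1), of \<alpha>]
      by (simp add: u v pairing_linear A' sum_delta_mult)
    then show "(\<Sum>\<epsilon>\<in>UNIV. A \<alpha> \<epsilon> l * N$\<epsilon>$k) = (\<Sum>\<epsilon>\<in>UNIV. A \<alpha> \<epsilon> k * N$\<epsilon>$l)"
      by (simp add: right_diff_distrib sum_subtractf mult.assoc[symmetric] sum_delta_mult(1))
        (simp add: mult.assoc sum_delta_mult(2))
  qed
next
  fix N assume N: "N \<in> {N. \<forall>\<alpha> k l. (\<Sum>\<epsilon>\<in>UNIV. A \<alpha> \<epsilon> l * N$\<epsilon>$k) = (\<Sum>\<epsilon>\<in>UNIV. A \<alpha> \<epsilon> k * N$\<epsilon>$l)}"
  have "(\<Sum>\<epsilon>\<in>UNIV. \<Sum>i\<in>UNIV. mscale (A \<alpha> \<epsilon> i) (wedge (\<pi> \<epsilon> p + (\<Sum>j\<in>UNIV. N$\<epsilon>$j *s \<omega> j p)) (\<omega> i p)))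
      = (\<Sum>\<epsilon>\<in>UNIV. \<Sum>i\<in>UNIV. mscale (A \<alpha> \<epsilon> i) (wedge (\<pi> \<epsilon> p) (\<omega> i p)))" for \<alpha>
  proof -
    have "(\<Sum>\<epsilon>\<in>UNIV. \<Sum>i\<in>UNIV. mscale (A \<alpha> \<epsilon> i) (wedge (\<Sum>j\<in>UNIV. N$\<epsilon>$j *s \<omega> j p) (\<omega> i p)))
        = (\<Sum>\<epsilon>\<in>UNIV. \<Sum>i\<in>UNIV. \<Sum>j\<in>UNIV. mscale (A \<alpha> \<epsilon> i * N$\<epsilon>$j) (wedge (\<omega> j p) (\<omega> i p)))"
      by (simp add: wedge_linear cmat.scale_sum_right)
    also have "\<dots> = (\<Sum>i\<in>UNIV. \<Sum>\<epsilon>\<in>UNIV. \<Sum>j\<in>UNIV. mscale (A \<alpha> \<epsilon> i * N$\<epsilon>$j) (wedge (\<omega> j p) (\<omega> i p)))"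
      by (rule sum.swap)
    also have "\<dots> = (\<Sum>i\<in>UNIV. \<Sum>j\<in>UNIV. \<Sum>\<epsilon>\<in>UNIV. mscale (A \<alpha> \<epsilon> i * N$\<epsilon>$j) (wedge (\<omega> j p) (\<omega> i p)))"
      by (rule sum.cong[OF refl], rule sum.swap)
    also have "\<dots> = (\<Sum>i\<in>UNIV. \<Sum>j\<in>UNIV. mscale (\<Sum>\<epsilon>\<in>UNIV. A \<alpha> \<epsilon> i * N$\<epsilon>$j) (wedge (\<omega> j p) (\<omega> i p)))"
      by (simp add: cmat.scale_sum_left)
    also have "\<dots> = 0"
      using N by (intro wedge_symmetric_sum) blast
    finally show ?thesis
      by (simp add: wedge_linear(1) cmat.scale_right_distrib sum.distrib)
  qed
  note unchanged = this
  have "structure_equation \<theta> (\<lambda>i. \<omega> i p) (\<lambda>c. \<pi> c p + (\<Sum>i\<in>UNIV. N$c$i *s \<omega> i p)) p A \<tau>"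
    using se by (simp only: structure_equation_def unchanged simp_thms)
  with se show "N \<in> prolongation_parameters \<theta> \<omega> \<pi> p"
    unfolding prolongation_parameters_def by blast
qed

section \<open>The trilinear form of a cubic form\<close>

definition cubic3 :: "('b::finite \<Rightarrow> 'b \<Rightarrow> 'b \<Rightarrow> complex) \<Rightarrow> complex^'b \<Rightarrow> complex^'b \<Rightarrow> complex^'b \<Rightarrow>
    complex" where
  "cubic3 C x y z = (\<Sum>a\<in>UNIV. \<Sum>b\<in>UNIV. \<Sum>c\<in>UNIV. C a b c * x$a * y$b * z$c)"

definition symmetric_array :: "('b \<Rightarrow> 'b \<Rightarrow> 'b \<Rightarrow> complex) \<Rightarrow> bool" where
  "symmetric_array C \<longleftrightarrow> (\<forall>a b c. C a b c = C b a c \<and> C a b c = C a c b)"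

lemma cubic3_linear:
  "cubic3 C (x + x') y z = cubic3 C x y z + cubic3 C x' y z"
  "cubic3 C x (y + y') z = cubic3 C x y z + cubic3 C x y' z"
  "cubic3 C x y (z + z') = cubic3 C x y z + cubic3 C x y z'"
  "cubic3 C (x - x') y z = cubic3 C x y z - cubic3 C x' y z"
  "cubic3 C x (y - y') z = cubic3 C x y z - cubic3 C x y' z"
  "cubic3 C x y (z - z') = cubic3 C x y z - cubic3 C x y z'"
  "cubic3 C (k *s x) y z = k * cubic3 C x y z"
  "cubic3 C x (k *s y) z = k * cubic3 C x y z"
  "cubic3 C x y (k *s z) = k * cubic3 C x y z"
  "cubic3 C 0 y z = 0" "cubic3 C x 0 z = 0" "cubic3 C x y 0 = 0"
  by (simp_all add: cubic3_def algebra_simps sum.distrib sum_subtractf sum_distrib_left)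

lemma cubic3_swap:
  assumes "symmetric_array C"
  shows "cubic3 C x y z = cubic3 C y x z" "cubic3 C x y z = cubic3 C x z y"
proof -
  have C: "C a b c = C b a c" "C a b c = C a c b" for a b c
    using assms unfolding symmetric_array_def by blast+
  show "cubic3 C x y z = cubic3 C y x z"
    unfolding cubic3_def by (subst sum.swap) (intro sum.cong refl, subst C(1), simp add: ac_simps)
  show "cubic3 C x y z = cubic3 C x z y"
    unfolding cubic3_def
    by (rule sum.cong[OF refl], rule trans[OF sum.swap], intro sum.cong refl, subst C(2)) (simp
        add: ac_simps)
qed

lemma sum_axis_mult:
  fixes f :: "'b::finite \<Rightarrow> complex"
  shows "(\<Sum>a\<in>UNIV. f a * axis k 1 $ a) = f k"
proof -
  have "(\<Sum>a\<in>UNIV. f a * axis k 1 $ a) = (\<Sum>a\<in>UNIV. f a * (if a = k then 1 else 0))"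
    by (intro sum.cong refl) (simp add: axis_def)
  then show ?thesis by (simp add: sum_delta_mult)
qed

lemma cubic3_axis3: "cubic3 C x y (axis c 1) = (\<Sum>a\<in>UNIV. \<Sum>b\<in>UNIV. C a b c * x$a * y$b)"
  by (simp add: cubic3_def sum_axis_mult)

lemma cubic3_expand3: "(\<Sum>c\<in>UNIV. cubic3 C x y (axis c 1) * z$c) = cubic3 C x y z"
proof -
  have "(\<Sum>c\<in>UNIV. cubic3 C x y (axis c 1) * z$c)
      = (\<Sum>c\<in>UNIV. \<Sum>a\<in>UNIV. \<Sum>b\<in>UNIV. C a b c * x$a * y$b * z$c)"
    by (simp add: cubic3_axis3 sum_distrib_right)
  also have "\<dots> = (\<Sum>a\<in>UNIV. \<Sum>c\<in>UNIV. \<Sum>b\<in>UNIV. C a b c * x$a * y$b * z$c)"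
    by (rule sum.swap)
  also have "\<dots> = cubic3 C x y z"
    unfolding cubic3_def by (rule sum.cong[OF refl], rule sum.swap)
  finally show ?thesis .
qed

lemma cubic_as_cubic3: "cubic C t = cubic3 C t t t"
  by (simp add: cubic_def cubic3_def)

lemma cubic3_axis1: "cubic3 C (axis a 1) y z = (\<Sum>b\<in>UNIV. \<Sum>c\<in>UNIV. C a b c * y$b * z$c)"
proof -
  have "cubic3 C (axis a 1) y z
      = (\<Sum>a'\<in>UNIV. (\<Sum>b\<in>UNIV. \<Sum>c\<in>UNIV. C a' b c * y$b * z$c) * axis a 1 $ a')"
    unfolding cubic3_def by (simp add: sum_distrib_left ac_simps)
  then show ?thesis by (simp only: sum_axis_mult)
qed

lemma cubic1_as_cubic3: "cubic1 C a t = cubic3 C (axis a 1) t t"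
  by (simp add: cubic1_def cubic3_axis1)

lemma cubic2_as_cubic3: "cubic2 C a b t = cubic3 C (axis a 1) (axis b 1) t"
proof -
  have "cubic3 C (axis a 1) (axis b 1) t = (\<Sum>b'\<in>UNIV. (\<Sum>c\<in>UNIV. C a b' c * t$c) * axis b 1 $ b')"
    by (simp add: cubic3_axis1 sum_distrib_left ac_simps)
  then show ?thesis by (simp only: sum_axis_mult cubic2_def)
qed

text \<open>
  Equations between coefficients and equations between vectors are translated into each other
  argument by argument.
\<close>

lemma linear_functional_eq_0_iff_axis:
  "(\<forall>a. f (axis a 1) = 0) \<longleftrightarrow> (\<forall>x. f x = 0)"
  if "\<And>x y. f (x + y) = f x + f y" "\<And>k x. f (k *s x) = k * f x" for f :: "complex^'b::finite \<Rightarrow>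
      complex"
proof
  assume *: "\<forall>a. f (axis a 1) = 0"
  have 0: "f 0 = 0" using that(2)[of 0 0] by simp
  have "f (sum g S) = (\<Sum>i\<in>S. f (g i))" if "finite S" for g and S :: "'b set"
    using that by (induction S rule: finite_induct) (simp_all add: 0 \<open>\<And>x y. f (x + y) = f x + f y\<close>)
  then have "f (\<Sum>a\<in>UNIV. x$a *s axis a 1) = 0" for x
    using * that(2) by simp
  then show "\<forall>x. f x = 0" by (simp add: basis_expansion)
qed blast

section \<open>The structure equations of the system\<close>

lemma ext_deriv_eq_sum_wedge:
  fixes \<alpha> \<beta> :: "'k \<Rightarrow> 'c::finite covector"
  assumes "\<And>\<mu> \<nu>. partial \<mu> (\<lambda>q. \<theta> q $ \<nu>) p = (\<Sum>k\<in>K. \<alpha> k $ \<mu> * \<beta> k $ \<nu>)"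
  shows "ext_deriv \<theta> p = (\<Sum>k\<in>K. wedge (\<alpha> k) (\<beta> k))"
  by (simp add: ext_deriv_def assms wedge_def vec_eq_iff sum_subtractf)

lemma tpart_line: "tpart (p + axis \<mu> z) = tpart p + z *s tpart (axis \<mu> 1)"
  by (simp add: tpart_def vec_eq_iff axis_def)

lemma partial_const: "partial \<mu> (\<lambda>q. c) p = 0"
  by (simp add: partial_def)

lemma partial_cubic:
  assumes C: "symmetric_array C"
  shows "partial \<mu> (\<lambda>q. k * cubic C (tpart q)) p = k * (3 * cubic3 C (tpart p) (tpart p) (tpart
      (axis \<mu> 1)))"
    and "partial \<mu> (\<lambda>q. k * cubic1 C a (tpart q)) p = k * (2 * cubic3 C (axis a 1) (tpart p)
        (tpart (axis \<mu> 1)))"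
    and "partial \<mu> (\<lambda>q. k * cubic2 C a b (tpart q)) p = k * cubic3 C (axis a 1) (axis b 1)
        (tpart (axis \<mu> 1))"
proof -
  let ?t = "tpart p" and ?s = "tpart (axis \<mu> 1)"
  note sw = cubic3_swap[OF C]
  have "cubic3 C ?t ?s ?t = cubic3 C ?t ?t ?s" "cubic3 C ?s ?t ?t = cubic3 C ?t ?t ?s"
    "cubic3 C ?s ?t ?s = cubic3 C ?t ?s ?s" "cubic3 C ?s ?s ?t = cubic3 C ?t ?s ?s"
    using sw(2)[of ?t ?s ?t] sw(1)[of ?s ?t ?t] sw(1)[of ?s ?t ?s] sw(2)[of ?s ?s ?t] by simp_all
  then have 3: "k * cubic C (?t + z *s ?s) = k * (cubic3 C ?t ?t ?t + 3 * z * cubic3 C ?t ?t ?s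
      + 3 * z^2 * cubic3 C ?t ?s ?s + z^3 * cubic3 C ?s ?s ?s)" for z
    by (simp add: cubic_as_cubic3 cubic3_linear algebra_simps power2_eq_square power3_eq_cube)
  have "cubic3 C (axis a 1) ?s ?t = cubic3 C (axis a 1) ?t ?s"
    by (rule sw)
  then have 2: "k * cubic1 C a (?t + z *s ?s) = k * (cubic3 C (axis a 1) ?t ?t
      + 2 * z * cubic3 C (axis a 1) ?t ?s + z^2 * cubic3 C (axis a 1) ?s ?s)" for z
    by (simp add: cubic1_as_cubic3 cubic3_linear algebra_simps power2_eq_square)
  have 1: "k * cubic2 C a b (?t + z *s ?s) = k * (cubic3 C (axis a 1) (axis b 1) ?t
      + z * cubic3 C (axis a 1) (axis b 1) ?s)" for z
    by (simp add: cubic2_as_cubic3 cubic3_linear)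
  show "partial \<mu> (\<lambda>q. k * cubic C (tpart q)) p = k * (3 * cubic3 C ?t ?t ?s)"
    unfolding partial_def tpart_line 3
    by (rule DERIV_imp_deriv) (auto intro!: derivative_eq_intros)
  show "partial \<mu> (\<lambda>q. k * cubic1 C a (tpart q)) p = k * (2 * cubic3 C (axis a 1) ?t ?s)"
    unfolding partial_def tpart_line 2
    by (rule DERIV_imp_deriv) (auto intro!: derivative_eq_intros)
  show "partial \<mu> (\<lambda>q. k * cubic2 C a b (tpart q)) p = k * cubic3 C (axis a 1) (axis b 1) ?s"
    unfolding partial_def tpart_line 1
    by (rule DERIV_imp_deriv) (auto intro!: derivative_eq_intros)
qed

text \<open>
  The coefficients of all \<open>d\<theta>\<^sub>\<alpha>\<close> are values \<open>C(r, \<cdot>, \<cdot>)\<close>: the row of \<open>\<theta>\<^sub>a\<close> is the basis vector \<open>w\<^sub>a\<close>, and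
  the row of \<open>\<theta>\<^sub>0\<close> is \<open>t\<close>, because \<open>\<theta>\<^sub>0 - t\<^sup>a \<theta>\<^sub>a\<close> is closed modulo \<open>I\<close>.  The row of \<open>\<sigma>\<close> is zero.
\<close>

definition row_vector :: "complex^'b coord \<Rightarrow> ('b::finite) option option \<Rightarrow> complex^'b" where
  "row_vector p \<alpha> = (case \<alpha> of None \<Rightarrow> 0 | Some None \<Rightarrow> tpart p | Some (Some a) \<Rightarrow> axis a 1)"

definition column_vector :: "('b::finite) option \<Rightarrow> complex^'b" where
  "column_vector i = (case i of None \<Rightarrow> 0 | Some b \<Rightarrow> axis b 1)"

text \<open>
  The vector in \<open>W\<close> of the components \<open>\<omega>\<^sup>b(\<partial>\<^sub>\<nu>)\<close>, \<open>1 \<le> b \<le> n - 1\<close>.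
\<close>

definition omega_column :: "complex^'b coord \<Rightarrow> ('b::finite) coord \<Rightarrow> complex^'b" where
  "omega_column p \<nu> = (case \<nu> of X None \<Rightarrow> 3 *s tpart p | X (Some b) \<Rightarrow> 3 *s axis b 1 | _ \<Rightarrow> 0)"

lemma dcoord_nth: "dcoord \<mu> $ \<nu> = (if \<nu> = \<mu> then 1 else 0)"
  by (simp add: dcoord_def axis_def)

lemma sum_delta_mult_sym:
  fixes f :: "('b::finite) \<Rightarrow> complex"
  shows "(\<Sum>a\<in>UNIV. f a * (if b = a then 1 else 0)) = f b"
  using sum_delta_mult(1)[of f b] by (simp add: eq_commute)

text \<open>
  The factors 1, 3/2 and 3 in \<open>\<theta>\<^sub>0\<close> and \<open>\<theta>\<^sub>a\<close> are such that the derivatives 3, 2 and 1 of the cubic,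
  quadratic and linear coefficients all become the factor 3 of \<open>\<omega>\<^sup>b = 3 (dx\<^sup>b + t\<^sup>b dx\<^sup>0)\<close>.
\<close>

lemma partial_theta:
  assumes C: "symmetric_array C"
  shows "partial \<mu> (\<lambda>q. I_forms C (Some \<alpha>) q $ \<nu>) p
    = - cubic3 C (row_vector p (Some \<alpha>)) (omega_column p \<nu>) (tpart (axis \<mu> 1))"
proof -
  note partial_cubic' = partial_cubic(1)[OF C, where k="-1"] partial_cubic(2)[OF C, where
      k="-(3/2)"]
    partial_cubic(3)[OF C, where k="-3"]
  show ?thesis
  proof (cases \<alpha>)
    case None
    have "(\<lambda>q. I_forms C (Some \<alpha>) q $ \<nu>) =
        (case \<nu> of X None \<Rightarrow> (\<lambda>q. -1 * cubic C (tpart q))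
           | X (Some b) \<Rightarrow> (\<lambda>q. -(3/2) * cubic1 C b (tpart q))
           | P None \<Rightarrow> (\<lambda>q. 1) | _ \<Rightarrow> (\<lambda>q. 0))"
      by (auto simp: fun_eq_iff None I_forms_def theta0_def dcoord_nth sum_delta_mult_sym
          sum_divide_distrib[symmetric] split: coord.splits option.splits)
    then show ?thesis
      using cubic3_swap(1)[OF C, of "tpart p" "axis _ 1" "tpart (axis \<mu> 1)"]
      by (auto simp: None row_vector_def omega_column_def partial_cubic'[simplified]
          partial_const cubic3_linear
          split: coord.splits option.splits)
  next
    case (Some a)
    have "(\<lambda>q. I_forms C (Some \<alpha>) q $ \<nu>) =
        (case \<nu> of X None \<Rightarrow> (\<lambda>q. -(3/2) * cubic1 C a (tpart q))
           | X (Some b) \<Rightarrow> (\<lambda>q. -3 * cubic2 C a b (tpart q))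
           | P (Some a') \<Rightarrow> (\<lambda>q. if a' = a then 1 else 0) | _ \<Rightarrow> (\<lambda>q. 0))"
      by (auto simp: fun_eq_iff Some I_forms_def theta_def dcoord_nth sum_delta_mult_sym split:
          coord.splits option.splits)
    then show ?thesis
      by (auto simp: Some row_vector_def omega_column_def partial_cubic'[simplified]
          partial_const cubic3_linear
          split: coord.splits option.splits)
  qed
qed

definition system_coefficient ::
  "('b::finite \<Rightarrow> 'b \<Rightarrow> 'b \<Rightarrow> complex) \<Rightarrow> complex^'b coord \<Rightarrow> 'b option option \<Rightarrow> 'b \<Rightarrow> 'b option \<Rightarrow>
      complex" where
  "system_coefficient C p \<alpha> c i = - cubic3 C (row_vector p \<alpha>) (column_vector i) (axis c 1)"

lemma omega_column_expand:
  "omega_column p \<nu> = (\<Sum>i\<in>UNIV. omega i p $ \<nu> *s column_vector i)"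
proof -
  have "(\<Sum>i\<in>UNIV. omega i p $ \<nu> *s column_vector i) = (\<Sum>b\<in>UNIV. omega (Some b) p $ \<nu> *s axis b 1)"
    by (simp add: UNIV_option_conv sum.reindex column_vector_def)
  also have "\<dots> = (\<chi> b. omega (Some b) p $ \<nu>)"
    using basis_expansion[of "\<chi> b. omega (Some b) p $ \<nu>"] by simp
  also have "\<dots> = omega_column p \<nu>"
    by (auto simp: vec_eq_iff omega_column_def omega_def dcoord_nth tpart_def axis_def split:
        coord.splits option.splits)
  finally show ?thesis by simp
qed

lemma ext_deriv_theta:
  fixes C :: "'b::finite \<Rightarrow> 'b \<Rightarrow> 'b \<Rightarrow> complex"
  assumes C: "symmetric_array C"
  shows "ext_deriv (I_forms C (Some \<alpha>)) p =
    (\<Sum>c\<in>UNIV. \<Sum>i\<in>UNIV. mscale (system_coefficient C p (Some \<alpha>) c i) (wedge (dt c p) (omega i p)))"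
proof -
  let ?A = "system_coefficient C p (Some \<alpha>)"
  have s: "tpart (axis \<mu> 1) $ c = dt c p $ \<mu>" for \<mu> :: "'b coord" and c
    by (auto simp: tpart_def dt_def dcoord_nth axis_def)
  have sum2: "cubic3 C x (sum g S) z = (\<Sum>i\<in>S. cubic3 C x (g i) z)" if "finite S" for x z g and S
      :: "'b option set"
    using that by (induction S rule: finite_induct) (simp_all add: cubic3_linear)
  have "partial \<mu> (\<lambda>q. I_forms C (Some \<alpha>) q $ \<nu>) p
      = (\<Sum>k\<in>UNIV. ((case k of (c, i) \<Rightarrow> ?A c i) *s dt (fst k) p) $ \<mu> * omega (snd k) p $ \<nu>)" for \<mu> \<nu>
  proof -
    have "partial \<mu> (\<lambda>q. I_forms C (Some \<alpha>) q $ \<nu>) p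
        = - (\<Sum>c\<in>UNIV. cubic3 C (row_vector p (Some \<alpha>)) (omega_column p \<nu>) (axis c 1) * dt c p $ \<mu>)"
      unfolding partial_theta[OF C] s[symmetric] cubic3_expand3 ..
    also have "\<dots> = (\<Sum>c\<in>UNIV. \<Sum>i\<in>UNIV. ?A c i * dt c p $ \<mu> * omega i p $ \<nu>)"
      by (simp add: omega_column_expand sum2 cubic3_linear system_coefficient_def sum_distrib_left
          sum_negf ac_simps)
    finally show ?thesis
      by (simp add: sum.cartesian_product UNIV_Times_UNIV[symmetric] case_prod_unfold del:
          UNIV_Times_UNIV)
  qed
  then have "ext_deriv (I_forms C (Some \<alpha>)) p
      = (\<Sum>k\<in>UNIV. wedge ((case k of (c, i) \<Rightarrow> ?A c i) *s dt (fst k) p) (omega (snd k) p))"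
    by (rule ext_deriv_eq_sum_wedge)
  then show ?thesis
    by (simp add: wedge_linear sum.cartesian_product UNIV_Times_UNIV[symmetric] case_prod_unfold
        del: UNIV_Times_UNIV)
qed

lemma wedge_minus: "wedge (- \<alpha>) \<beta> = - wedge \<alpha> \<beta>"
  by (simp add: wedge_def vec_eq_iff)

lemma ext_deriv_sigma:
  fixes p :: "complex^('b::finite) coord"
  shows "ext_deriv sigma p = (\<Sum>i\<in>UNIV. wedge (- dcoord (P i)) (dcoord (X i)))"
proof (rule ext_deriv_eq_sum_wedge)
  fix \<mu> \<nu> :: "'b coord"
  have D: "((\<lambda>z. - (p + axis \<mu> z) $ P i) has_field_derivative (- dcoord (P i) $ \<mu>)) (at 0)" for i
    by (auto simp: axis_def dcoord_nth intro!: derivative_eq_intros)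
  have "(\<lambda>q. sigma q $ \<nu>) = (case \<nu> of X i \<Rightarrow> (\<lambda>q. - q $ P i) | U \<Rightarrow> (\<lambda>q. 1) | _ \<Rightarrow> (\<lambda>q. 0))"
    by (auto simp: fun_eq_iff sigma_def dcoord_nth sum_delta_mult_sym split: coord.splits)
  then show "partial \<mu> (\<lambda>q. sigma q $ \<nu>) p = (\<Sum>i\<in>UNIV. (- dcoord (P i)) $ \<mu> * dcoord (X i) $ \<nu>)"
    using DERIV_imp_deriv[OF D]
    by (auto simp: partial_const dcoord_nth[of "X _" \<nu>] partial_def sum_negf sum_delta_mult_sym
        split: coord.splits)
qed

text \<open>
  \<open>d\<sigma> = - du\<^sub>i \<and> dx\<^sup>i\<close>, and modulo the \<open>\<theta>\<^sub>i\<close> the \<open>du\<^sub>i\<close> are \<open>u\<^sub>i\<^sub>j dx\<^sup>j\<close> with \<open>u\<^sub>i\<^sub>j\<close> symmetric.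
\<close>

lemma ext_deriv_sigma_ideal:
  fixes C :: "'b::finite \<Rightarrow> 'b \<Rightarrow> 'b \<Rightarrow> complex"
  assumes C: "symmetric_array C"
  shows "ext_deriv sigma p \<in> ideal2 (fibre (I_forms C) p)"
proof -
  \<comment> \<open>the second derivatives \<open>u\<^sub>i\<^sub>j\<close> prescribed by the differential equation\<close>
  define S where "S i j = (case (i, j) of (None, None) \<Rightarrow> cubic C (tpart p)
      | (None, Some a) \<Rightarrow> 3/2 * cubic1 C a (tpart p) | (Some a, None) \<Rightarrow> 3/2 * cubic1 C a (tpart p)
      | (Some a, Some b) \<Rightarrow> 3 * cubic2 C a b (tpart p))" for i j
  have S: "S i j = S j i" for i j
    using cubic3_swap(1)[OF C] by (auto simp: S_def cubic2_as_cubic3 split: option.splits)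
  have P: "dcoord (P i) = I_forms C (Some i) p + (\<Sum>j\<in>UNIV. S i j *s dcoord (X j))" for i
    by (cases i) (simp_all add: I_forms_def theta0_def theta_def UNIV_option_conv sum.reindex S_def)
  have "ext_deriv sigma p = - (\<Sum>i\<in>UNIV. wedge (I_forms C (Some i) p) (dcoord (X i)))
      - (\<Sum>i\<in>UNIV. \<Sum>j\<in>UNIV. mscale (S i j) (wedge (dcoord (X j)) (dcoord (X i))))"
    unfolding ext_deriv_sigma P
    by (simp add: wedge_minus wedge_linear sum_subtractf sum_negf sum.distrib)
  also have "\<dots> = - (\<Sum>i\<in>UNIV. wedge (I_forms C (Some i) p) (dcoord (X i)))"
    using S by (simp add: wedge_symmetric_sum)
  also have "\<dots> \<in> ideal2 (fibre (I_forms C) p)"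
    unfolding ideal2_def fibre_def
    by (intro cmat.span_neg cmat.span_sum cmat.span_base) (blast intro: vec.span_base)
  finally show ?thesis .
qed

theorem structure_equation_system:
  fixes C :: "'b::finite \<Rightarrow> 'b \<Rightarrow> 'b \<Rightarrow> complex"
  assumes C: "symmetric_array C"
  shows "structure_equation (I_forms C) (\<lambda>i. omega i p) (\<lambda>c. dt c p) p
    (system_coefficient C p) (\<lambda>_ _ _. 0)"
  unfolding structure_equation_def
proof
  fix \<alpha>
  show "ext_deriv (I_forms C \<alpha>) p
      - (\<Sum>\<epsilon>\<in>UNIV. \<Sum>i\<in>UNIV. mscale (system_coefficient C p \<alpha> \<epsilon> i) (wedge (dt \<epsilon> p) (omega i p)))
      - (\<Sum>i\<in>UNIV. \<Sum>j\<in>UNIV. mscale 0 (wedge (omega i p) (omega j p))) \<in> ideal2 (fibre (I_forms C) p)"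
  proof (cases \<alpha>)
    case None
    then have "I_forms C \<alpha> = sigma" "system_coefficient C p \<alpha> = (\<lambda>c i. 0)"
      by (simp_all add: I_forms_def system_coefficient_def row_vector_def cubic3_linear fun_eq_iff)
    then show ?thesis using ext_deriv_sigma_ideal[OF C] by simp
  next
    case (Some \<beta>)
    then show ?thesis by (simp add: ext_deriv_theta[OF C] ideal2_def cmat.span_zero)
  qed
qed

lemma structure_equation_imp_linear_pfaffian:
  fixes \<theta> :: "'s \<Rightarrow> 'c::finite one_form"
    and \<omega> :: "'n::finite \<Rightarrow> 'c one_form" and \<pi> :: "'r::finite \<Rightarrow> 'c one_form"
  assumes frame: "adapted_coframe \<theta> J \<omega> \<pi>"
    and se: "\<And>p. structure_equation \<theta> (\<lambda>i. \<omega> i p) (\<lambda>c. \<pi> c p) p (A p) (\<tau> p)"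
  shows "linear_pfaffian \<theta> J"
  unfolding linear_pfaffian_def
proof (intro allI conjI)
  fix p \<alpha>
  have J: "J p = vec.span (range (\<lambda>\<alpha>. \<theta> \<alpha> p) \<union> range (\<lambda>i. \<omega> i p))"
    using frame unfolding adapted_coframe_def Let_def by metis
  show sub: "fibre \<theta> p \<subseteq> J p"
    unfolding fibre_def J by (rule vec.span_mono) blast
  have \<omega>: "\<omega> i p \<in> J p" for i
    unfolding J by (rule vec.span_base) simp
  have wedge1: "wedge (\<omega> i p) \<beta> \<in> ideal2 (J p)" for i \<beta>
    unfolding ideal2_def using \<omega> by (intro cmat.span_base) blast
  have wedge2: "wedge \<beta> (\<omega> i p) \<in> ideal2 (J p)" for i \<beta>
    using wedge1 by (subst wedge_anticommute) (simp add: ideal2_def cmat.span_neg)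
  have "ext_deriv (\<theta> \<alpha>) p
      - (\<Sum>\<epsilon>\<in>UNIV. \<Sum>i\<in>UNIV. mscale (A p \<alpha> \<epsilon> i) (wedge (\<pi> \<epsilon> p) (\<omega> i p)))
      - (\<Sum>i\<in>UNIV. \<Sum>j\<in>UNIV. mscale (\<tau> p \<alpha> i j) (wedge (\<omega> i p) (\<omega> j p))) \<in> ideal2 (fibre \<theta> p)" (is
          "?d - ?a - ?t \<in> _")
    using se unfolding structure_equation_def by blast
  moreover have "ideal2 (fibre \<theta> p) \<subseteq> ideal2 (J p)"
    unfolding ideal2_def using sub by (intro cmat.span_mono) blast
  ultimately have "?d - ?a - ?t \<in> ideal2 (J p)" by blast
  moreover have "?a \<in> ideal2 (J p)" "?t \<in> ideal2 (J p)"
    using wedge1 wedge2 unfolding ideal2_def by (intro cmat.span_sum cmat.span_scale; simp)+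
  ultimately have "(?d - ?a - ?t) + ?t + ?a \<in> ideal2 (J p)"
    unfolding ideal2_def by (intro cmat.span_add)
  then show "ext_deriv (\<theta> \<alpha>) p \<in> ideal2 (J p)" by simp
qed

section \<open>The tableau and its Cartan characters\<close>

definition xpart :: "complex^('b::finite option) \<Rightarrow> complex^'b" where
  "xpart \<xi> = (\<chi> b. \<xi> $ Some b)"

definition system_matrix :: "('b::finite \<Rightarrow> 'b \<Rightarrow> 'b \<Rightarrow> complex) \<Rightarrow> complex^'b coord \<Rightarrow> complex^'b \<Rightarrow>
    complex^'b option^'b option option" where
  "system_matrix C p v = (\<chi> \<alpha> i. cubic3 C (row_vector p \<alpha>) (column_vector i) v)"

definition nondegenerate_at :: "('b::finite \<Rightarrow> 'b \<Rightarrow> 'b \<Rightarrow> complex) \<Rightarrow> complex^'b \<Rightarrow> bool" where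
  "nondegenerate_at C e \<longleftrightarrow> (\<forall>x. (\<forall>z. cubic3 C e x z = 0) \<longrightarrow> x = 0)"

lemma cubic3_sum2:
  assumes "finite S" shows "cubic3 C x (sum g S) z = (\<Sum>i\<in>S. cubic3 C x (g i) z)"
  using assms by (induction S rule: finite_induct) (simp_all add: cubic3_linear)

lemma xpart_expand: "(\<Sum>i\<in>UNIV. \<xi>$i *s column_vector i) = xpart \<xi>"
proof -
  have "(\<Sum>i\<in>UNIV. \<xi>$i *s column_vector i) = (\<Sum>b\<in>UNIV. xpart \<xi> $ b *s axis b 1)"
    by (simp add: UNIV_option_conv sum.reindex column_vector_def xpart_def)
  then show ?thesis by (simp add: basis_expansion)
qed

lemma system_matrix_mult:
  "(system_matrix C p v *v \<xi>) $ \<alpha> = cubic3 C (row_vector p \<alpha>) (xpart \<xi>) v"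
  unfolding xpart_expand[symmetric]
  by (simp add: matrix_vector_mult_def system_matrix_def cubic3_sum2 cubic3_linear mult.commute)

text \<open>
  The row of \<open>\<theta>\<^sub>0\<close> is a combination of the rows of the \<open>\<theta>\<^sub>a\<close>, which are a basis, so the rows can be
  replaced by arbitrary vectors of \<open>W\<close>.
\<close>

lemma forall_row_vector:
  assumes "\<And>x y. f (x + y) = f x + f y" "\<And>k x. f (k *s x) = k * f x"
  shows "(\<forall>\<alpha>. f (row_vector p \<alpha>) = 0) \<longleftrightarrow> (\<forall>x. f x = 0)"
proof
  assume *: "\<forall>\<alpha>. f (row_vector p \<alpha>) = 0"
  have "f (axis a 1) = 0" for a
    using *[rule_format, of "Some (Some a)"] by (simp add: row_vector_def)
  then show "\<forall>x. f x = 0"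
    using linear_functional_eq_0_iff_axis[of f, OF assms] by blast
qed blast

lemma system_matrix_mult_eq_0:
  assumes C: "symmetric_array C"
  shows "system_matrix C p v *v \<xi> = 0 \<longleftrightarrow> (\<forall>z. cubic3 C (xpart \<xi>) v z = 0)"
proof -
  have "system_matrix C p v *v \<xi> = 0 \<longleftrightarrow> (\<forall>\<alpha>. cubic3 C (row_vector p \<alpha>) (xpart \<xi>) v = 0)"
    by (simp add: vec_eq_iff system_matrix_mult)
  also have "\<dots> \<longleftrightarrow> (\<forall>z. cubic3 C z (xpart \<xi>) v = 0)"
    by (rule forall_row_vector) (simp_all add: cubic3_linear)
  also have "\<dots> \<longleftrightarrow> (\<forall>z. cubic3 C (xpart \<xi>) v z = 0)"
    by (metis cubic3_swap[OF C])
  finally show ?thesis .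
qed

lemma tableau_system:
  assumes C: "symmetric_array C"
  shows "tableau (I_forms C) (J_fibre C) omega p = range (system_matrix C p)"
proof -
  have neg: "cubic3 C x y (- z) = - cubic3 C x y z" for x y z
    using cubic3_linear(6)[of C x y 0 z] by (simp add: cubic3_linear)
  have eq: "(\<chi> \<alpha> i. \<Sum>\<epsilon>\<in>UNIV. system_coefficient C p \<alpha> \<epsilon> i * w \<epsilon>) = system_matrix C p (- (\<chi> c. w
      c))" for w
    using cubic3_expand3[of C _ _ "\<chi> c. w c"]
    by (simp add: vec_eq_iff system_coefficient_def system_matrix_def neg sum_negf)
  have "system_matrix C p v \<in> range (\<lambda>w. system_matrix C p (- (\<chi> c. w c)))" for v
    by (rule range_eqI[where x="\<lambda>c. - v$c"]) (rule arg_cong[where f="system_matrix C p"], simp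
        add: vec_eq_iff)
  then show ?thesis
    unfolding tableau_eq[OF adapted_coframe_omega_dt structure_equation_system[OF C]] eq by blast
qed

lemma linear_system_matrix: "Vector_Spaces.linear (*s) mscale (system_matrix C p)"
  unfolding Vector_Spaces.linear_iff
  by (intro conjI vec.vector_space_axioms cmat.vector_space_axioms)
    (simp_all add: system_matrix_def mscale_def vec_eq_iff cubic3_linear)

lemma nondegenerate_at_generic_vector:
  assumes C: "symmetric_array C" and e: "nondegenerate_at C (xpart \<xi>)" and "system_matrix C p v
      *v \<xi> = 0"
  shows "v = 0"
  using e assms(3) unfolding system_matrix_mult_eq_0[OF C] nondegenerate_at_def by blast

definition embed :: "complex^('b::finite) \<Rightarrow> complex^'b option" where
  "embed x = (\<chi> i. case i of None \<Rightarrow> 0 | Some b \<Rightarrow> x$b)"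

lemma xpart_embed [simp]: "xpart (embed x) = x"
  by (simp add: xpart_def embed_def vec_eq_iff)

lemma linear_xpart_embed:
  "xpart (\<xi> + \<eta>) = xpart \<xi> + xpart \<eta>" "xpart (k *s \<xi>) = k *s xpart \<xi>" "xpart 0 = 0"
  "embed (x + y) = embed x + embed y" "embed (k *s x) = k *s embed x" "embed 0 = 0"
  by (auto simp: xpart_def embed_def vec_eq_iff split: option.splits)

lemma dim_range_system_matrix:
  fixes C :: "'b::finite \<Rightarrow> 'b \<Rightarrow> 'b \<Rightarrow> complex"
  assumes C: "symmetric_array C" and e: "nondegenerate_at C e"
  shows "cmat.dim (range (system_matrix C p)) = CARD('b)"
proof -
  have "inj (system_matrix C p)"
  proof (rule vec_cmat.linear_inj_iff_eq_0[OF linear_system_matrix, THEN iffD2], intro allI impI)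
    fix v assume "system_matrix C p v = 0"
    then have "system_matrix C p v *v embed e = 0" by simp
    then show "v = 0"
      using nondegenerate_at_generic_vector[OF C, of "embed e"] e by simp
  qed
  then have "cmat.dim (range (system_matrix C p)) = vec.dim (UNIV :: (complex^'b) set)"
    by (intro vec_cmat.dim_injective_linear_image linear_system_matrix) (simp add: vec.span_UNIV)
  then show ?thesis by (simp add: vec.dim_UNIV card_cart_basis)
qed

lemma exists_ordered_basis_hd:
  fixes \<xi> :: "complex^'n::finite"
  assumes "\<xi> \<noteq> 0"
  obtains b where "ordered_basis (\<xi> # b)"
proof -
  define B where "B = vec.extend_basis {\<xi>}"
  have "vec.independent {\<xi>}" using assms by (simp add: vec.dependent_single)
  then have B: "{\<xi>} \<subseteq> B" "vec.independent B" "vec.span B = UNIV"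
    unfolding B_def
    by (rule vec.extend_basis_superset vec.independent_extend_basis vec.span_extend_basis)+
  then have "finite (B - {\<xi>})" using vec.finiteI_independent by blast
  then obtain b where "set b = B - {\<xi>}" "distinct b"
    using finite_distinct_list by blast
  with B have "ordered_basis (\<xi> # b)"
    by (auto simp: ordered_basis_def insert_absorb)
  then show thesis by (rule that)
qed

text \<open>
  An element \<open>C(\<cdot>, \<cdot>, v)\<close> of the tableau annihilates a vector over \<open>e\<close> only if \<open>C(e, v, \<cdot>) = 0\<close>, that
  is, \<open>v = 0\<close>.  A basis that starts with such a vector attains the least possible dimensions
  \<open>dim W, 0, 0, \<dots>\<close>, so every generic basis does.
\<close>

theorem cartan_character_system:
  fixes C :: "'b::finite \<Rightarrow> 'b \<Rightarrow> 'b \<Rightarrow> complex"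
  assumes C: "symmetric_array C" and e: "nondegenerate_at C e"
  shows "cartan_character (tableau (I_forms C) (J_fibre C) omega p) 1 = CARD('b)"
    and "k \<ge> 2 \<Longrightarrow> cartan_character (tableau (I_forms C) (J_fibre C) omega p) k = 0"
proof -
  let ?A = "range (system_matrix C p)"
  have A0: "tableau_kernel ?A b 0 = ?A" for b
    by (simp add: tableau_kernel_def)
  have e0: "embed e \<noteq> 0"
  proof
    assume "embed e = 0"
    then have "e = 0" by (metis xpart_embed linear_xpart_embed(3))
    \<comment> \<open>the index type is nonempty, so \<open>W\<close> has a nonzero vector\<close>
    then have "(axis undefined 1 :: complex^'b) = 0"
      using e unfolding nondegenerate_at_def by (simp add: cubic3_linear)
    then show False by simp
  qed
  obtain b0 where b0: "ordered_basis (embed e # b0)"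
    using exists_ordered_basis_hd[OF e0] .
  have A1: "cmat.dim (tableau_kernel ?A (embed e # b0) k) = 0" if k: "k \<ge> 1" for k
  proof -
    have "tableau_kernel ?A (embed e # b0) k \<subseteq> {0}"
    proof
      fix M assume "M \<in> tableau_kernel ?A (embed e # b0) k"
      then obtain v where v: "M = system_matrix C p v" "M *v embed e = 0"
        using k by (cases k) (auto simp: tableau_kernel_def)
      then have "v = 0"
        using nondegenerate_at_generic_vector[OF C, of "embed e"] e by simp
      then show "M \<in> {0}"
        using v(1) vec_cmat.linear_0[OF linear_system_matrix] by simp
    qed
    then have "cmat.dim (tableau_kernel ?A (embed e # b0) k) \<le> card ({} :: (complex^'b option^'b
        option option) set)"
      by (intro cmat.dim_le_card) auto
    then show ?thesis by simp
  qed
  have "generic_basis ?A (embed e # b0)"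
    unfolding generic_basis_def
  proof (intro conjI allI impI b0)
    fix b' k
    show "cmat.dim (tableau_kernel ?A (embed e # b0) k) \<le> cmat.dim (tableau_kernel ?A b' k)"
      by (cases "k = 0") (simp_all add: A0 A1)
  qed
  then have gen: "generic_basis ?A (SOME b. generic_basis ?A b)"
    by (rule someI)
  have dim_k: "cmat.dim (tableau_kernel ?A (SOME b. generic_basis ?A b) k) = 0" if "k \<ge> 1" for k
  proof -
    have "cmat.dim (tableau_kernel ?A (SOME b. generic_basis ?A b) k)
        \<le> cmat.dim (tableau_kernel ?A (embed e # b0) k)"
      using gen b0 unfolding generic_basis_def[of _ "SOME b. generic_basis ?A b"] by blast
    then show ?thesis by (simp add: A1[OF that])
  qed
  show "cartan_character (tableau (I_forms C) (J_fibre C) omega p) 1 = CARD('b)"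
    unfolding tableau_system[OF C] cartan_character_def Let_def
    by (simp add: A0 dim_k dim_range_system_matrix[OF C e])
  show "cartan_character (tableau (I_forms C) (J_fibre C) omega p) k = 0" if "k \<ge> 2"
    unfolding tableau_system[OF C] cartan_character_def Let_def
    using that by (simp add: dim_k)
qed

section \<open>The prolongation\<close>

lemma prolongation_system:
  fixes C :: "'b::finite \<Rightarrow> 'b \<Rightarrow> 'b \<Rightarrow> complex"
  assumes C: "symmetric_array C"
  shows "prolongation_parameters (I_forms C) omega dt p =
    {N. \<forall>x \<xi> \<eta>. cubic3 C x (xpart \<xi>) (N *v \<eta>) = cubic3 C x (xpart \<eta>) (N *v \<xi>)}"
proof -
  have x: "xpart (axis i 1) = column_vector i" for i :: "'b option"
    by (auto simp: xpart_def column_vector_def vec_eq_iff axis_def split: option.splits)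
  have N: "(\<Sum>\<epsilon>\<in>UNIV. system_coefficient C p \<alpha> \<epsilon> l * N$\<epsilon>$k)
      = - cubic3 C (row_vector p \<alpha>) (column_vector l) (N *v axis k 1)" for N :: "complex^'b
          option^'b" and \<alpha> k l
  proof -
    have "N$\<epsilon>$k = (N *v axis k 1)$\<epsilon>" for \<epsilon>
      by (simp add: matrix_vector_mult_def sum_axis_mult)
    then show ?thesis
      by (simp only: system_coefficient_def mult_minus_left sum_negf cubic3_expand3)
  qed
  have "(\<forall>\<alpha> k l. (\<Sum>\<epsilon>\<in>UNIV. system_coefficient C p \<alpha> \<epsilon> l * N$\<epsilon>$k) = (\<Sum>\<epsilon>\<in>UNIV. system_coefficient
      C p \<alpha> \<epsilon> k * N$\<epsilon>$l))
      \<longleftrightarrow> (\<forall>x \<xi> \<eta>. cubic3 C x (xpart \<xi>) (N *v \<eta>) = cubic3 C x (xpart \<eta>) (N *v \<xi>))" for N ::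
          "complex^'b option^'b"
  proof -
    let ?D = "\<lambda>x \<xi> \<eta>. cubic3 C x (xpart \<xi>) (N *v \<eta>) - cubic3 C x (xpart \<eta>) (N *v \<xi>)"
    note lin = cubic3_linear linear_xpart_embed matrix_vector_right_distrib
        vector_scalar_commute algebra_simps
    have "(\<forall>\<alpha> k l. (\<Sum>\<epsilon>\<in>UNIV. system_coefficient C p \<alpha> \<epsilon> l * N$\<epsilon>$k) = (\<Sum>\<epsilon>\<in>UNIV.
        system_coefficient C p \<alpha> \<epsilon> k * N$\<epsilon>$l))
        \<longleftrightarrow> (\<forall>k l \<alpha>. ?D (row_vector p \<alpha>) (axis l 1) (axis k 1) = 0)"
      unfolding N x by auto
    also have "\<dots> \<longleftrightarrow> (\<forall>k l x. ?D x (axis l 1) (axis k 1) = 0)"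
      by (intro all_cong1 forall_row_vector) (simp_all add: lin)
    also have "\<dots> \<longleftrightarrow> (\<forall>x k l. ?D x (axis l 1) (axis k 1) = 0)" by blast
    also have "\<dots> \<longleftrightarrow> (\<forall>x k \<xi>. ?D x \<xi> (axis k 1) = 0)"
      by (intro all_cong1 linear_functional_eq_0_iff_axis) (simp_all add: lin)
    also have "\<dots> \<longleftrightarrow> (\<forall>x \<xi> k. ?D x \<xi> (axis k 1) = 0)" by blast
    also have "\<dots> \<longleftrightarrow> (\<forall>x \<xi> \<eta>. ?D x \<xi> \<eta> = 0)"
      by (intro all_cong1 linear_functional_eq_0_iff_axis) (simp_all add: lin)
    finally show ?thesis by simp
  qed
  then show ?thesis
    unfolding prolongation_parameters_eq[OF adapted_coframe_omega_dt
        structure_equation_system[OF C]] by blast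
qed

text \<open>
  The prolongation in terms of \<open>W\<close> alone: the endomorphisms that can be moved freely between the
  three arguments of the trilinear form.
\<close>

definition multiplier :: "('b::finite \<Rightarrow> 'b \<Rightarrow> 'b \<Rightarrow> complex) \<Rightarrow> (complex^'b \<Rightarrow> complex^'b) \<Rightarrow> bool" where
  "multiplier C f \<longleftrightarrow> (\<forall>x y. f (x + y) = f x + f y) \<and> (\<forall>k x. f (k *s x) = k *s f x) \<and>
     (\<forall>x y z. cubic3 C x y (f z) = cubic3 C x z (f y))"

text \<open>
  Evaluation at \<open>e\<close> embeds the prolongation into \<open>W\<close>, since \<open>C(x, e, N \<eta>) = C(x, \<eta>', N e)\<close>, where
  \<open>\<eta>'\<close> is the projection of \<open>\<eta>\<close> to \<open>W\<close>, and the left-hand side determines \<open>N \<eta>\<close>.  In particular the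
  column of \<open>N\<close> along \<open>\<omega>\<^sup>0\<close>, for which \<open>\<eta>' = 0\<close>, is zero.
\<close>

theorem dim_prolongation_system:
  fixes C :: "'b::finite \<Rightarrow> 'b \<Rightarrow> 'b \<Rightarrow> complex"
  assumes C: "symmetric_array C" and e: "nondegenerate_at C e"
  shows "cmat.dim (prolongation_parameters (I_forms C) omega dt p) = CARD('b) \<longleftrightarrow>
    (\<forall>a. \<exists>f. multiplier C f \<and> f e = a)"
proof -
  let ?K = "{N :: complex^'b option^'b. \<forall>x \<xi> \<eta>. cubic3 C x (xpart \<xi>) (N *v \<eta>) = cubic3 C x
      (xpart \<eta>) (N *v \<xi>)}"
  let ?ev = "\<lambda>N :: complex^'b option^'b. N *v embed e"
  note lin = cubic3_linear linear_xpart_embed matrix_vector_mult_add_rdistrib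
      matrix_vector_right_distrib
  have scale: "mscale c N *v \<xi> = c *s (N *v \<xi>)" for c and N :: "complex^'b option^'b" and \<xi>
    by (simp add: mscale_def matrix_vector_mult_def vec_eq_iff sum_distrib_left ac_simps)
  have nd: "y = 0" if "\<And>x. cubic3 C x e y = 0" for y
    using e that cubic3_swap[OF C] unfolding nondegenerate_at_def by metis
  have linear: "Vector_Spaces.linear mscale (*s) ?ev"
    unfolding Vector_Spaces.linear_iff
    by (intro conjI vec.vector_space_axioms cmat.vector_space_axioms) (simp_all add: scale lin)
  have sub: "cmat.subspace ?K"
    by (auto simp: cmat.subspace_def lin scale)
  have inj: "inj_on ?ev (cmat.span ?K)"
  proof -
    have "N = 0" if N: "N \<in> ?K" and "N *v embed e = 0" for N
    proof -
      have "N *v \<eta> = 0" for \<eta>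
      proof (rule nd)
        fix x
        have "cubic3 C x (xpart (embed e)) (N *v \<eta>) = cubic3 C x (xpart \<eta>) (N *v embed e)"
          using N by blast
        then show "cubic3 C x e (N *v \<eta>) = 0" by (simp add: that(2) cubic3_linear)
      qed
      then show "N = 0" by (simp add: matrix_eq)
    qed
    then show ?thesis
      unfolding cmat.span_eq_iff[THEN iffD2, OF sub]
      by (subst cmat_vec.linear_inj_on_iff_eq_0[OF linear sub]) blast
  qed
  have ev: "?ev ` ?K = {a. \<exists>f. multiplier C f \<and> f e = a}"
  proof (intro set_eqI iffI)
    fix a assume "a \<in> ?ev ` ?K"
    then obtain N where N: "N \<in> ?K" and a: "a = ?ev N" by (elim imageE)
    from N have "multiplier C (\<lambda>x. N *v embed x)"
      unfolding multiplier_def by (auto simp: lin vector_scalar_commute) (metis xpart_embed)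
    then show "a \<in> {a. \<exists>f. multiplier C f \<and> f e = a}" unfolding a by blast
  next
    fix a assume "a \<in> {a. \<exists>f. multiplier C f \<and> f e = a}"
    then obtain f where f: "multiplier C f" and a: "f e = a" by blast
    define N where "N = matrix (\<lambda>\<xi>. f (xpart \<xi>))"
    have "Vector_Spaces.linear (*s) (*s) (\<lambda>\<xi>. f (xpart \<xi>))"
      using f unfolding multiplier_def Vector_Spaces.linear_iff
      by (intro conjI vec.vector_space_axioms) (simp_all add: lin)
    then have N: "N *v \<xi> = f (xpart \<xi>)" for \<xi>
      unfolding N_def by (rule matrix_works)
    have "N \<in> ?K" using f unfolding multiplier_def by (simp add: N)
    moreover have "f e = ?ev N" by (simp add: N)
    ultimately show "a \<in> ?ev ` ?K" unfolding a[symmetric] by (rule image_eqI[rotated])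
  qed
  have "cmat.dim ?K = vec.dim (?ev ` ?K)"
    by (rule cmat_vec.dim_injective_linear_image[OF linear inj, symmetric])
  also have "vec.dim (?ev ` ?K) = CARD('b) \<longleftrightarrow> ?ev ` ?K = UNIV"
  proof -
    have "vec.span (?ev ` ?K) = ?ev ` ?K"
      unfolding cmat_vec.linear_span_image[OF linear] cmat.span_eq_iff[THEN iffD2, OF sub] ..
    with vec.dim_eq_full[of "?ev ` ?K"] show ?thesis
      unfolding vec.dimension_def card_cart_basis by presburger
  qed
  finally have "cmat.dim ?K = CARD('b) \<longleftrightarrow> (\<forall>a. \<exists>f. multiplier C f \<and> f e = a)"
    unfolding ev by (simp add: set_eq_iff)
  then show ?thesis unfolding prolongation_system[OF C] .
qed

corollary involutive_system_iff:
  fixes C :: "'b::finite \<Rightarrow> 'b \<Rightarrow> 'b \<Rightarrow> complex"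
  assumes C: "symmetric_array C" and e: "nondegenerate_at C e"
  shows "involutive_tableau (I_forms C) (J_fibre C) omega dt p \<longleftrightarrow> (\<forall>a. \<exists>f. multiplier C f \<and> f e = a)"
proof -
  let ?s = "cartan_character (tableau (I_forms C) (J_fibre C) omega p)"
  have "{1..CARD('b option)} = insert 1 {2..CARD('b option)}" by (auto simp: card_UNIV_option)
  then have "(\<Sum>k=1..CARD('b option). k * ?s k) = 1 * ?s 1 + (\<Sum>k=2..CARD('b option). k * ?s k)"
    by simp
  also have "\<dots> = CARD('b)"
    using cartan_character_system[OF C e] by simp
  finally have sum: "(\<Sum>k=1..CARD('b option). k * ?s k) = CARD('b)" .
  show ?thesis
    unfolding involutive_tableau_def sum dim_prolongation_system[OF C e, of p, symmetric] by
        (rule eq_commute)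
qed

text \<open>
  If a multiplier \<open>f\<close> maps \<open>e\<close> to \<open>a\<close>, then \<open>f (f e) = 0\<close> and \<open>f b = b\<close> by nondegeneracy; moving \<open>f\<close> twice
  from \<open>b\<close> to \<open>e\<close> in \<open>C(e, f (f b), \<cdot>)\<close> gives \<open>b = 0\<close>.
\<close>

theorem not_involutive_criterion:
  assumes C: "symmetric_array C" and e: "nondegenerate_at C e"
    and a: "\<And>z. cubic3 C a a z = 0" and b: "b \<noteq> 0" "\<And>z. cubic3 C a b z = cubic3 C e b z"
  shows "\<not> involutive_tableau (I_forms C) (J_fibre C) omega dt p"
proof
  assume "involutive_tableau (I_forms C) (J_fibre C) omega dt p"
  then obtain f where "multiplier C f" and fe: "f e = a"
    unfolding involutive_system_iff[OF C e] by blast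
  note sw = cubic3_swap[OF C]
  have f: "cubic3 C x y (f z) = cubic3 C x z (f y)" for x y z
    using \<open>multiplier C f\<close> unfolding multiplier_def by blast
  have f1: "cubic3 C x (f y) z = cubic3 C (f x) y z" for x y z
    by (metis f sw)
  have nd: "x = y" if "\<And>z. cubic3 C e x z = cubic3 C e y z" for x y
    using e that unfolding nondegenerate_at_def by (metis cubic3_linear(5) right_minus_eq)
  have "f a = 0"
    by (rule nd) (metis a f1 fe cubic3_linear(11))
  have "f b = b"
    by (rule nd) (metis b(2) f1 fe)
  have "b = 0"
    by (rule nd) (metis \<open>f a = 0\<close> \<open>f b = b\<close> f1 fe cubic3_linear(10,11))
  with b(1) show False by blast
qed

section \<open>Cubic forms on a vector space\<close>

text \<open>
  Polarization expresses the trilinear form through values of the cubic form, independently of a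
  basis of \<open>W\<close>.
\<close>

definition polar :: "('w::ab_group_add \<Rightarrow> complex) \<Rightarrow> 'w \<Rightarrow> 'w \<Rightarrow> 'w \<Rightarrow> complex" where
  "polar N x y z = (N (x + y + z) - N (x + y) - N (y + z) - N (x + z) + N x + N y + N z) / 6"

definition nondegenerate_in :: "'w::ab_group_add set \<Rightarrow> ('w \<Rightarrow> complex) \<Rightarrow> 'w \<Rightarrow> bool" where
  "nondegenerate_in W N e \<longleftrightarrow> e \<in> W \<and> (\<forall>x\<in>W. (\<forall>z\<in>W. polar N e x z = 0) \<longrightarrow> x = 0)"

lemma cubic3_eq_polar:
  assumes C: "symmetric_array C"
  shows "cubic3 C x y z = polar (cubic C) x y z"
proof -
  note sw = cubic3_swap[OF C]
  have xyz: "cubic3 C x z y = cubic3 C x y z" "cubic3 C y x z = cubic3 C x y z" "cubic3 C y z x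
      = cubic3 C x y z"
    "cubic3 C z x y = cubic3 C x y z" "cubic3 C z y x = cubic3 C x y z" for x y z
  proof -
    show "cubic3 C x z y = cubic3 C x y z" "cubic3 C y x z = cubic3 C x y z"
      by (rule sw)+
    show yzx: "cubic3 C y z x = cubic3 C x y z"
      by (rule trans[OF sw(2) sw(1)])
    show "cubic3 C z x y = cubic3 C x y z"
      by (rule trans[OF sw(1) sw(2)])
    show "cubic3 C z y x = cubic3 C x y z"
      by (rule trans[OF sw(1) yzx])
  qed
  have cyc: "cubic3 C x x y = cubic3 C x y x" "cubic3 C y x x = cubic3 C x y x" for x y
    by (rule xyz)+
  show ?thesis
    unfolding polar_def cubic_as_cubic3 cubic3_linear
    using xyz[of x y z] cyc by (simp add: algebra_simps)
qed

lemma polar_swap: "polar N x y z = polar N y x z" "polar N x y z = polar N x z y"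
  by (simp_all add: polar_def algebra_simps)

locale cubic_model = vector_space smul for smul :: "complex \<Rightarrow> 'w::ab_group_add \<Rightarrow> 'w" +
  fixes W :: "'w set" and N :: "'w \<Rightarrow> complex" and C :: "'b::finite \<Rightarrow> 'b \<Rightarrow> 'b \<Rightarrow> complex"
  assumes basis: "cubic_in_basis smul W N C"
begin

lemma symmetric: "symmetric_array C"
  using basis unfolding cubic_in_basis_def symmetric_array_def by blast

lemma coordinates:
  obtains \<phi> :: "complex^'b \<Rightarrow> 'w" where
    "Vector_Spaces.linear (*s) smul \<phi>" "inj \<phi>" "range \<phi> = W"
    "\<And>x y z. cubic3 C x y z = polar N (\<phi> x) (\<phi> y) (\<phi> z)"
proof -
  obtain w :: "'b \<Rightarrow> 'w" where w: "inj w" "independent (range w)" "span (range w) = W"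
      "\<And>t. N (\<Sum>a\<in>UNIV. smul (t$a) (w a)) = cubic C t"
    using basis unfolding cubic_in_basis_def by blast
  define \<phi> where "\<phi> t = (\<Sum>a\<in>UNIV. smul (t$a) (w a))" for t :: "complex^'b"
  interpret vp: vector_space_pair "(*s) :: complex \<Rightarrow> complex^'b \<Rightarrow> complex^'b" smul
    by unfold_locales
  have lin: "Vector_Spaces.linear (*s) smul \<phi>"
    unfolding Vector_Spaces.linear_iff
    by (intro conjI vec.vector_space_axioms vector_space_axioms)
      (simp_all add: \<phi>_def scale_left_distrib sum.distrib scale_sum_right)
  have inj: "inj \<phi>"
  proof (rule vp.linear_inj_iff_eq_0[OF lin, THEN iffD2], intro allI impI)
    fix t assume "\<phi> t = 0"
    then have "(\<Sum>v\<in>range w. smul (t $ inv w v) v) = 0"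
      using w(1) by (simp add: sum.reindex \<phi>_def)
    then have "\<forall>v\<in>range w. t $ inv w v = 0"
      using w(2) dependent_finite[of "range w"] by auto
    then show "t = 0" using w(1) by (simp add: vec_eq_iff)
  qed
  have "range \<phi> = W"
  proof (intro equalityI subsetI)
    fix x assume "x \<in> W"
    then obtain u where "x = (\<Sum>v\<in>range w. smul (u v) v)"
      unfolding w(3)[symmetric] span_finite[OF finite_imageI[OF finite]] by (elim rangeE)
    then have "x = \<phi> (\<chi> a. u (w a))"
      using w(1) by (simp add: \<phi>_def sum.reindex)
    then show "x \<in> range \<phi>" by (rule range_eqI)
  next
    fix x assume "x \<in> range \<phi>"
    then obtain t where x: "x = \<phi> t" by (elim rangeE)
    have "smul (t$a) (w a) \<in> span (range w)" for a
      by (intro span_scale span_base) simp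
    then show "x \<in> W"
      unfolding w(3)[symmetric] x \<phi>_def by (intro span_sum)
  qed
  moreover have "N (\<phi> t) = cubic C t" for t
    unfolding \<phi>_def by (rule w(4))
  then have "cubic3 C x y z = polar N (\<phi> x) (\<phi> y) (\<phi> z)" for x y z
    by (simp only: cubic3_eq_polar[OF symmetric] polar_def vp.linear_add[OF lin, symmetric])
  ultimately show thesis using that lin inj by blast
qed

lemma nondegenerate_at_coordinates:
  assumes "Vector_Spaces.linear (*s) smul \<phi>" "inj \<phi>" "range \<phi> = W"
    and "\<And>x y z. cubic3 C x y z = polar N (\<phi> x) (\<phi> y) (\<phi> z)"
    and "nondegenerate_in W N (\<phi> e)"
  shows "nondegenerate_at C e"
  unfolding nondegenerate_at_def
proof (intro allI impI)
  fix x assume x: "\<forall>z. cubic3 C e x z = 0"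
  have "\<phi> x \<in> W" "\<forall>z\<in>W. polar N (\<phi> e) (\<phi> x) z = 0"
    using x unfolding assms(3)[symmetric] assms(4) by auto
  then have "\<phi> x = 0" using assms(5) unfolding nondegenerate_in_def by blast
  moreover interpret vp: vector_space_pair "(*s) :: complex \<Rightarrow> complex^'b \<Rightarrow> complex^'b" smul
    by unfold_locales
  have "\<phi> 0 = 0" by (rule vp.linear_0[OF assms(1)])
  ultimately show "x = 0" using assms(2) by (metis injD)
qed

lemma polar_linear:
  assumes W: "x \<in> W" "y \<in> W" "z \<in> W" "z' \<in> W"
  shows "polar N x y (z + z') = polar N x y z + polar N x y z'"
    and "polar N x y (z - z') = polar N x y z - polar N x y z'"
    and "polar N x y (smul k z) = k * polar N x y z"
proof -
  obtain \<phi> :: "complex^'b \<Rightarrow> 'w" where \<phi>: "Vector_Spaces.linear (*s) smul \<phi>" "inj \<phi>" "range \<phi> = W"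
    "\<And>x y z. cubic3 C x y z = polar N (\<phi> x) (\<phi> y) (\<phi> z)"
    by (rule coordinates) (rule that)
  interpret vp: vector_space_pair "(*s) :: complex \<Rightarrow> complex^'b \<Rightarrow> complex^'b" smul
    by unfold_locales
  obtain a b c c' where *: "x = \<phi> a" "y = \<phi> b" "z = \<phi> c" "z' = \<phi> c'"
    using W unfolding \<phi>(3)[symmetric] by (elim rangeE)
  show "polar N x y (z + z') = polar N x y z + polar N x y z'"
    unfolding * vp.linear_add[OF \<phi>(1), symmetric] \<phi>(4)[symmetric] by (rule cubic3_linear)
  show "polar N x y (z - z') = polar N x y z - polar N x y z'"
    unfolding * vp.linear_diff[OF \<phi>(1), symmetric] \<phi>(4)[symmetric] by (rule cubic3_linear)
  show "polar N x y (smul k z) = k * polar N x y z"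
    unfolding * vp.linear_scale[OF \<phi>(1), symmetric] \<phi>(4)[symmetric] by (rule cubic3_linear)
qed

theorem not_involutive:
  assumes e: "nondegenerate_in W N e"
    and "a \<in> W" "b \<in> W" "b \<noteq> 0"
    and "\<And>z. z \<in> W \<Longrightarrow> polar N a a z = 0"
    and "\<And>z. z \<in> W \<Longrightarrow> polar N a b z = polar N e b z"
  shows "\<not> involutive_tableau (I_forms C) (J_fibre C) omega dt p"
proof -
  obtain \<phi> :: "complex^'b \<Rightarrow> 'w" where \<phi>: "Vector_Spaces.linear (*s) smul \<phi>" "inj \<phi>" "range \<phi> = W"
    "\<And>x y z. cubic3 C x y z = polar N (\<phi> x) (\<phi> y) (\<phi> z)"
    by (rule coordinates) (rule that)
  interpret vp: vector_space_pair "(*s) :: complex \<Rightarrow> complex^'b \<Rightarrow> complex^'b" smul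
    by unfold_locales
  obtain e' a' b' where eab: "e = \<phi> e'" "a = \<phi> a'" "b = \<phi> b'"
    using e assms(2,3) \<phi>(3) unfolding nondegenerate_in_def by blast
  have "b' \<noteq> 0" using assms(4) vp.linear_0[OF \<phi>(1)] eab by auto
  then show ?thesis
    using assms(5,6) \<phi>(3) eab
    by (intro not_involutive_criterion[OF symmetric nondegenerate_at_coordinates[OF \<phi> e[unfolded
        eab]], of a' b'])
      (auto simp: \<phi>(4))
qed

text \<open>
  The criterion with \<open>a = e\<^sub>1\<close> and \<open>b = e\<^sub>2 - e\<^sub>3\<close>: the terms with \<open>e\<^sub>2\<close> and \<open>e\<^sub>3\<close> in \<open>C(e, b, \<cdot>)\<close> are
  \<open>C(e\<^sub>2, e\<^sub>2, \<cdot>) - C(e\<^sub>3, e\<^sub>3, \<cdot>)\<close>.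
\<close>

theorem not_involutive_three_null:
  assumes e: "nondegenerate_in W N (e1 + e2 + e3)" and W: "e1 \<in> W" "e2 \<in> W" "e3 \<in> W" and "e2 \<noteq> e3"
    and null: "\<And>z. z \<in> W \<Longrightarrow> polar N e1 e1 z = 0" "\<And>z. z \<in> W \<Longrightarrow> polar N e2 e2 z = 0"
      "\<And>z. z \<in> W \<Longrightarrow> polar N e3 e3 z = 0"
  shows "\<not> involutive_tableau (I_forms C) (J_fibre C) omega dt p"
proof -
  obtain \<phi> :: "complex^'b \<Rightarrow> 'w" where \<phi>: "Vector_Spaces.linear (*s) smul \<phi>" "inj \<phi>" "range \<phi> = W"
    "\<And>x y z. cubic3 C x y z = polar N (\<phi> x) (\<phi> y) (\<phi> z)"
    by (rule coordinates) (rule that)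
  interpret vp: vector_space_pair "(*s) :: complex \<Rightarrow> complex^'b \<Rightarrow> complex^'b" smul
    by unfold_locales
  obtain f1 f2 f3 where f: "e1 = \<phi> f1" "e2 = \<phi> f2" "e3 = \<phi> f3"
    using W \<phi>(3) by blast
  have sum: "e1 + e2 + e3 = \<phi> (f1 + f2 + f3)"
    by (simp add: f vp.linear_add[OF \<phi>(1)])
  have nd: "nondegenerate_at C (f1 + f2 + f3)"
    using nondegenerate_at_coordinates[OF \<phi>] e unfolding sum by blast
  have f0: "cubic3 C f1 f1 z = 0" "cubic3 C f2 f2 z = 0" "cubic3 C f3 f3 z = 0" for z
    using null \<phi>(3) unfolding \<phi>(4) f by blast+
  show ?thesis
  proof (rule not_involutive_criterion[OF symmetric nd, of f1 "f2 - f3"])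
    show "f2 - f3 \<noteq> 0" using f assms(5) by auto
    show "cubic3 C f1 (f2 - f3) z = cubic3 C (f1 + f2 + f3) (f2 - f3) z" for z
      using cubic3_swap(1)[OF symmetric, of f3 f2 z] f0 by (simp add: cubic3_linear)
  qed (rule f0)
qed

end

section \<open>The spin factors\<close>

lemma vector_space_spin_scale: "vector_space spin_scale"
  by unfold_locales (auto simp: spin_scale_def plus_fun_def algebra_simps split: prod.splits)

lemma gram_form_linear:
  "gram_form m g (u + v) w = gram_form m g u w + gram_form m g v w"
  "gram_form m g w (u + v) = gram_form m g w u + gram_form m g w v"
  "gram_form m g (\<lambda>i. k * u i) w = k * gram_form m g u w"
  "gram_form m g 0 w = 0" "gram_form m g w 0 = 0"
  by (simp_all add: gram_form_def algebra_simps sum.distrib sum_distrib_left)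

lemma gram_form_sym:
  assumes "nondegenerate_symmetric m g"
  shows "gram_form m g u v = gram_form m g v u"
proof -
  have "gram_form m g u v = (\<Sum>j<m. \<Sum>i<m. g i j * u i * v j)"
    unfolding gram_form_def by (rule sum.swap)
  also have "\<dots> = gram_form m g v u"
    using assms unfolding gram_form_def nondegenerate_symmetric_def
    by (intro sum.cong refl) auto
  finally show ?thesis .
qed

lemma polar_spin_cubic:
  assumes "nondegenerate_symmetric m g"
  shows "polar (spin_cubic m g) (u, k) (v, l) (w, n) =
    (gram_form m g u v * n + gram_form m g u w * l + gram_form m g v w * k) / 3"
  using gram_form_sym[OF assms, of v u] gram_form_sym[OF assms, of w u] gram_form_sym[OF assms,
      of w v]
  by (simp add: polar_def spin_cubic_def gram_form_linear algebra_simps)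

lemma cspace_closed:
  "0 \<in> cspace m" "u \<in> cspace m \<Longrightarrow> v \<in> cspace m \<Longrightarrow> u + v \<in> cspace m"
  "u \<in> cspace m \<Longrightarrow> (\<lambda>i. k * u i) \<in> cspace m"
  by (auto simp: cspace_def)

definition unit_vector :: "nat \<Rightarrow> nat \<Rightarrow> complex" where
  "unit_vector k = (\<lambda>i. if i = k then 1 else 0)"

lemma unit_vector: "k < m \<Longrightarrow> unit_vector k \<in> cspace m" "unit_vector k \<noteq> 0"
  by (auto simp: unit_vector_def cspace_def fun_eq_iff)

text \<open>
  A form that vanishes on the diagonal vanishes identically, by polarization.
\<close>

lemma exists_anisotropic:
  assumes g: "nondegenerate_symmetric m g" and "1 \<le> m"
  obtains u where "u \<in> cspace m" "gram_form m g u u \<noteq> 0"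
proof -
  have "\<exists>u\<in>cspace m. gram_form m g u u \<noteq> 0"
  proof (rule ccontr)
    assume "\<not> ?thesis"
    then have iso: "gram_form m g u u = 0" if "u \<in> cspace m" for u
      using that by blast
    have "gram_form m g (unit_vector 0) w = 0" if w: "w \<in> cspace m" for w
    proof -
      have e: "unit_vector 0 \<in> cspace m" using assms(2) unit_vector by simp
      then have "gram_form m g (unit_vector 0 + w) (unit_vector 0 + w) = 0"
        using w iso cspace_closed by blast
      then show ?thesis
        using gram_form_sym[OF g, of w "unit_vector 0"] iso w e by (simp add: gram_form_linear)
    qed
    then have "unit_vector 0 = (0 :: nat \<Rightarrow> complex)"
      using g assms(2) unit_vector(1)[of 0 m] unfolding nondegenerate_symmetric_def by auto
    then show False using unit_vector by blast
  qed
  then show thesis using that by blast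
qed

text \<open>
  A linear functional on a space of dimension at least 2 has a nonzero kernel; inside
  \<open>\<C>\<^sup>2 \<subseteq> \<C>\<^sup>m\<close> a kernel vector can be written down.
\<close>

lemma exists_orthogonal:
  assumes "2 \<le> m"
  obtains v where "v \<in> cspace m" "v \<noteq> 0" "gram_form m g u v = 0"
proof (cases "gram_form m g u (unit_vector 0) = 0")
  case True
  then show thesis using that unit_vector(2) unit_vector(1)[of 0 m] assms by auto
next
  case False
  let ?a = "gram_form m g u (unit_vector 1)" and ?b = "gram_form m g u (unit_vector 0)"
  let ?v = "(\<lambda>i. ?a * unit_vector 0 i) + (\<lambda>i. - ?b * unit_vector 1 i)"
  have "gram_form m g w (\<lambda>i. k * z i) = k * gram_form m g w z" for k w z
    by (simp add: gram_form_def sum_distrib_left ac_simps)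
  then have "gram_form m g u ?v = 0" by (simp only: gram_form_linear) (simp add: algebra_simps)
  moreover have "?v 1 \<noteq> 0" using False by (simp add: unit_vector_def)
  then have "?v \<noteq> 0" by (metis zero_fun_apply)
  moreover have "?v \<in> cspace m" using assms unit_vector(1) by (intro cspace_closed) auto
  ultimately show thesis using that by blast
qed

text \<open>
  If \<open>(v, l)\<close> is orthogonal to everything, the test vectors \<open>(0, 1)\<close> and \<open>(w, 0)\<close> give \<open>\<langle>u, v\<rangle> = 0\<close> and
  \<open>v = - l u\<close>, so that \<open>l \<langle>u, u\<rangle> = 0\<close>.
\<close>

lemma spin_nondegenerate:
  assumes g: "nondegenerate_symmetric m g" and u: "u \<in> cspace m" "gram_form m g u u \<noteq> 0"
  shows "nondegenerate_in (spin_factor m) (spin_cubic m g) (u, 1)"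
  unfolding nondegenerate_in_def
proof (intro conjI ballI impI)
  show "(u, 1) \<in> spin_factor m" using u by (simp add: spin_factor_def)
  fix x assume "x \<in> spin_factor m" and x0: "\<forall>z\<in>spin_factor m. polar (spin_cubic m g) (u, 1) x z = 0"
  then obtain v l where x: "x = (v, l)" "v \<in> cspace m" unfolding spin_factor_def by blast
  have eq: "gram_form m g u v * n + gram_form m g u w * l + gram_form m g v w = 0" if "w \<in>
      cspace m" for w n
    using x0[rule_format, of "(w, n)"] that by (simp add: x polar_spin_cubic[OF g] spin_factor_def)
  have uv: "gram_form m g u v = 0"
    using eq[of 0 1] by (simp add: cspace_closed gram_form_linear)
  have "gram_form m g (v + (\<lambda>i. l * u i)) w = 0" if "w \<in> cspace m" for w
    using eq[OF that, of 0] by (simp add: gram_form_linear algebra_simps)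
  then have v: "v + (\<lambda>i. l * u i) = 0"
    using g x u cspace_closed unfolding nondegenerate_symmetric_def by blast
  then have "gram_form m g u (v + (\<lambda>i. l * u i)) = 0" by (simp add: gram_form_linear)
  then have "l = 0"
    using uv u(2) gram_form_sym[OF g, of u "\<lambda>i. l * u i"] by (simp add: gram_form_linear)
  with v show "x = 0" by (simp add: x zero_prod_def zero_fun_def plus_fun_def)
qed

text \<open>
  The element \<open>(0, 1)\<close> is null because the cubic is linear in the last coordinate.  On vectors
  orthogonal to \<open>u\<close> it acts like \<open>(u, 1)\<close>.
\<close>

theorem spin_factor_not_involutive:
  assumes "spin_factor_cubic m C" and m: "2 \<le> m"
  shows "\<not> involutive_tableau (I_forms C) (J_fibre C) omega dt p"
proof -
  obtain g where g: "nondegenerate_symmetric m g"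
    and C: "cubic_in_basis spin_scale (spin_factor m) (spin_cubic m g) C"
    using assms(1) unfolding spin_factor_cubic_def by blast
  interpret vector_space spin_scale by (rule vector_space_spin_scale)
  interpret cubic_model spin_scale "spin_factor m" "spin_cubic m g" C
    by unfold_locales (rule C)
  obtain u where u: "u \<in> cspace m" "gram_form m g u u \<noteq> 0"
    using exists_anisotropic[OF g] m by auto
  obtain v where v: "v \<in> cspace m" "v \<noteq> 0" "gram_form m g u v = 0"
    using exists_orthogonal[OF m] .
  show ?thesis
  proof (rule not_involutive[OF spin_nondegenerate[OF g u], of "(0, 1)" "(v, 0)"])
    show "polar (spin_cubic m g) (0, 1) (0, 1) z = 0" for z
      by (cases z) (simp add: polar_spin_cubic[OF g] gram_form_linear)
    show "polar (spin_cubic m g) (0, 1) (v, 0) z = polar (spin_cubic m g) (u, 1) (v, 0) z" for z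
      by (cases z) (simp add: polar_spin_cubic[OF g] gram_form_linear v)
  qed (use v in \<open>auto simp: spin_factor_def cspace_closed zero_prod_def\<close>)
qed

text \<open>
  Here \<open>W\<close> has a basis \<open>e, f\<close> for which \<open>C(e, e, f)\<close> is, up to the order of the
  arguments, the only nonzero value of the trilinear form.
  The nilpotent map \<open>e \<mapsto> f\<close>, \<open>f \<mapsto> 0\<close> is a multiplier, since \<open>C(x, y, f)\<close> is the product of the
  \<open>e\<close>-coordinates of \<open>x\<close> and \<open>y\<close> up to a factor.
\<close>

theorem spin_factor_one_involutive:
  fixes C :: "'b::finite \<Rightarrow> 'b \<Rightarrow> 'b \<Rightarrow> complex"
  assumes "spin_factor_cubic 1 C"
  shows "symmetric_array C \<and> CARD('b) = 2 \<and> (\<exists>e. nondegenerate_at C e \<and> (\<forall>a. \<exists>f. multiplier C f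
      \<and> f e = a))"
proof -
  obtain g where g: "nondegenerate_symmetric 1 g"
    and C: "cubic_in_basis spin_scale (spin_factor 1) (spin_cubic 1 g) C"
    using assms unfolding spin_factor_cubic_def by blast
  interpret vector_space spin_scale by (rule vector_space_spin_scale)
  interpret cubic_model spin_scale "spin_factor 1" "spin_cubic 1 g" C
    by unfold_locales (rule C)
  obtain \<phi> :: "complex^'b \<Rightarrow> _" where \<phi>: "Vector_Spaces.linear (*s) spin_scale \<phi>" "inj \<phi>" "range
      \<phi> = spin_factor 1"
    "\<And>x y z. cubic3 C x y z = polar (spin_cubic 1 g) (\<phi> x) (\<phi> y) (\<phi> z)"
    by (rule coordinates) (rule that)
  interpret vp: vector_space_pair "(*s) :: complex \<Rightarrow> complex^'b \<Rightarrow> complex^'b" spin_scale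
    by unfold_locales
  obtain e f where e: "\<phi> e = (unit_vector 0, 0)" and f: "\<phi> f = (0, 1)"
    using \<phi>(3) unit_vector(1)[of 0 1] cspace_closed(1)[of 1] unfolding spin_factor_def
    by (metis (no_types, lifting) SigmaI UNIV_I imageE zero_less_one)
  have gram: "gram_form 1 g v w = g 0 0 * v 0 * w 0" for v w
    by (simp add: gram_form_def)
  obtain u where u: "u \<in> cspace 1" "gram_form 1 g u u \<noteq> 0"
    using exists_anisotropic[OF g] by auto
  then have g0: "g 0 0 \<noteq> 0" unfolding gram by auto
  note polar = polar_spin_cubic[OF g]
  have c: "cubic3 C e e e = 0" "cubic3 C e e f = g 0 0 / 3" "cubic3 C e f f = 0" "cubic3 C f f f
      = 0"
    unfolding \<phi>(4) e f polar gram by (simp_all add: unit_vector_def)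
  have expand: "\<exists>k l. x = k *s e + l *s f" for x
  proof -
    obtain v l where "\<phi> x = (v, l)" and v: "v \<in> cspace 1"
      using \<phi>(3) unfolding spin_factor_def by blast
    moreover have "v = (\<lambda>i. v 0 * unit_vector 0 i)"
      using v by (auto simp: cspace_def unit_vector_def)
    ultimately have "\<phi> x = spin_scale (v 0) (\<phi> e) + spin_scale l (\<phi> f)"
      by (simp add: e f spin_scale_def plus_fun_def)
    then have "\<phi> x = \<phi> (v 0 *s e + l *s f)"
      by (simp add: vp.linear_add[OF \<phi>(1)] vp.linear_scale[OF \<phi>(1)])
    then show ?thesis using \<phi>(2) by (blast dest: injD)
  qed
  note sw = cubic3_swap[OF symmetric]
  have c': "cubic3 C e f e = g 0 0 / 3" "cubic3 C f e e = g 0 0 / 3" "cubic3 C f e f = 0"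
      "cubic3 C f f e = 0"
    using c sw(2)[of e f e] sw(1)[of f e e] sw(1)[of f e f] sw(2)[of f f e] by simp_all
  have nd: "nondegenerate_at C e"
    unfolding nondegenerate_at_def
  proof (intro allI impI)
    fix x assume x: "\<forall>z. cubic3 C e x z = 0"
    obtain k l where "x = k *s e + l *s f" using expand by blast
    moreover from this have "k = 0" "l = 0"
      using x[rule_format, of e] x[rule_format, of f] g0 by (simp_all add: cubic3_linear c c')
    ultimately show "x = 0" by simp
  qed
  \<comment> \<open>\<open>C(e, f, x)\<close> is the \<open>e\<close>-coordinate of \<open>x\<close>, up to the factor \<open>C(e, f, e)\<close>\<close>
  have mult: "multiplier C (\<lambda>x. k *s x + (l * cubic3 C e f x) *s f)" for k l
    unfolding multiplier_def
  proof (intro conjI allI)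
    fix x y z
    obtain x1 x2 y1 y2 z1 z2 where "x = x1 *s e + x2 *s f" "y = y1 *s e + y2 *s f" "z = z1 *s e
        + z2 *s f"
      using expand by metis
    then show "cubic3 C x y (k *s z + (l * cubic3 C e f z) *s f) = cubic3 C x z (k *s y + (l *
        cubic3 C e f y) *s f)"
      by (simp add: cubic3_linear c c' algebra_simps)
  qed (simp_all add: cubic3_linear vec_eq_iff algebra_simps)
  have "\<exists>f. multiplier C f \<and> f e = a" for a
  proof -
    obtain k l where "a = k *s e + l *s f" using expand by blast
    then have "a = k *s e + (3 * l / g 0 0 * cubic3 C e f e) *s f"
      using g0 by (simp add: c')
    then show ?thesis
      using mult[of k "3 * l / g 0 0"] by blast
  qed
  moreover have "CARD('b) = 2"
  proof -
    have "e \<noteq> f" using c c' g0 by auto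
    have "vec.span {e, f} = UNIV"
    proof -
      have "x \<in> vec.span {e, f}" for x
      proof -
        obtain k l where x: "x = k *s e + l *s f" using expand by blast
        show ?thesis unfolding x by (intro vec.span_add vec.span_scale vec.span_base) simp_all
      qed
      then show ?thesis by blast
    qed
    moreover have "vec.independent {e, f}"
    proof -
      have "f \<noteq> 0" using c g0 by (auto simp: cubic3_linear)
      moreover have "e \<notin> vec.span {f}"
      proof
        assume "e \<in> vec.span {f}"
        then obtain k where "e = k *s f" unfolding vec.span_singleton by blast
        then show False using c g0 by (simp add: cubic3_linear)
      qed
      ultimately show ?thesis using \<open>e \<noteq> f\<close> by (simp add: vec.independent_insert
          vec.dependent_single)
    qed
    ultimately have "vec.dim (UNIV :: (complex^'b) set) = card {e, f}"
      by (metis vec.dim_span_eq_card_independent)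
    then show ?thesis using \<open>e \<noteq> f\<close> by (simp add: vec.dim_UNIV card_cart_basis)
  qed
  ultimately show ?thesis using nd symmetric by blast
qed

section \<open>The cubic of \<open>G\<^sub>2\<close>\<close>

theorem one_dimensional_involutive:
  fixes C :: "'b::finite \<Rightarrow> 'b \<Rightarrow> 'b \<Rightarrow> complex"
  assumes C: "cubic_in_basis (*) UNIV (\<lambda>t::complex. t^3 / 3) C"
  shows "symmetric_array C \<and> CARD('b) = 1 \<and> (\<exists>e. nondegenerate_at C e \<and> (\<forall>a. \<exists>f. multiplier C f
      \<and> f e = a))"
proof -
  interpret cubic_model "(*)" UNIV "\<lambda>t::complex. t^3 / 3" C
    by unfold_locales (rule C)
  obtain \<phi> :: "complex^'b \<Rightarrow> _" where \<phi>: "Vector_Spaces.linear (*s) (*) \<phi>" "inj \<phi>" "range \<phi> = UNIV"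
    "\<And>x y z. cubic3 C x y z = polar (\<lambda>t::complex. t^3 / 3) (\<phi> x) (\<phi> y) (\<phi> z)"
    by (rule coordinates) (rule that)
  interpret vp: vector_space_pair "(*s) :: complex \<Rightarrow> complex^'b \<Rightarrow> complex^'b" "(*) :: complex \<Rightarrow> _"
    by unfold_locales
  have polar: "polar (\<lambda>t::complex. t^3 / 3) x y z = x * y * z / 3" for x y z
    by (simp add: polar_def power3_eq_cube field_simps)
  obtain e where e: "\<phi> e = 1" using \<phi>(3) by (metis UNIV_I imageE)
  have expand: "x = \<phi> x *s e" for x
    using \<phi>(2) by (rule injD) (simp add: vp.linear_scale[OF \<phi>(1)] e)
  have nd: "nondegenerate_at C e"
    by (rule nondegenerate_at_coordinates[OF \<phi>]) (auto simp: nondegenerate_in_def polar e)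
  have mult: "multiplier C (\<lambda>x. k *s x)" for k
    by (auto simp: multiplier_def cubic3_linear vector_add_ldistrib vector_smult_assoc
        mult.commute cubic3_swap(2)[OF symmetric])
  have "\<exists>f. multiplier C f \<and> f e = a" for a
    using mult[of "\<phi> a"] expand[of a] by auto
  moreover have "CARD('b) = 1"
  proof -
    have e0: "e \<noteq> 0" using e vp.linear_0[OF \<phi>(1)] by auto
    have "x \<in> vec.span {e}" for x
      by (subst expand) (intro vec.span_scale vec.span_base, simp)
    then have "vec.span {e} = UNIV" by blast
    moreover have "vec.independent {e}" using e0 by (simp add: vec.dependent_single)
    ultimately have "vec.dim (UNIV :: (complex^'b) set) = card {e}"
      by (metis vec.dim_span_eq_card_independent)
    then show ?thesis by (simp add: vec.dim_UNIV card_cart_basis)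
  qed
  ultimately show ?thesis using nd symmetric by blast
qed

section \<open>Diagonal matrices\<close>

definition matrix_unit :: "3 \<Rightarrow> complex^3^3" where
  "matrix_unit i = (\<chi> r c. if r = i \<and> c = i then 1 else 0)"

lemma polar_det_diagonal:
  assumes "x \<in> diagonal_matrices" "y \<in> diagonal_matrices" "z \<in> diagonal_matrices"
  shows "polar det x y z = (x$1$1 * (y$2$2 * z$3$3 + y$3$3 * z$2$2) + x$2$2 * (y$1$1 * z$3$3 +
      y$3$3 * z$1$1)
    + x$3$3 * (y$1$1 * z$2$2 + y$2$2 * z$1$1)) / 6"
proof -
  have "m$1$2 = 0" "m$1$3 = 0" "m$2$1 = 0" "m$2$3 = 0" "m$3$1 = 0" "m$3$2 = 0"
    if "m \<in> diagonal_matrices" for m :: "complex^3^3"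
    using that by (auto simp: diagonal_matrices_def)
  with assms show ?thesis by (simp add: polar_def det_3 algebra_simps)
qed

theorem diagonal_not_involutive:
  assumes C: "cubic_in_basis mscale diagonal_matrices det C"
  shows "\<not> involutive_tableau (I_forms C) (J_fibre C) omega dt p"
proof -
  interpret cubic_model mscale diagonal_matrices det C
    by unfold_locales (rule C)
  have E: "matrix_unit i \<in> diagonal_matrices" for i
    by (simp add: matrix_unit_def diagonal_matrices_def)
  have e: "matrix_unit 1 + matrix_unit 2 + matrix_unit 3 \<in> diagonal_matrices" (is "?e \<in> _")
    using E by (simp add: diagonal_matrices_def)
  have nd: "nondegenerate_in diagonal_matrices det ?e"
    unfolding nondegenerate_in_def
  proof (intro conjI ballI impI e)
    fix x assume x: "x \<in> diagonal_matrices" and "\<forall>z\<in>diagonal_matrices. polar det ?e x z = 0"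
    then have polar: "polar det ?e x (matrix_unit i) = 0" for i using E by blast
    have "x$2$2 + x$3$3 = 0" "x$1$1 + x$3$3 = 0" "x$1$1 + x$2$2 = 0"
      using polar[of 1] polar[of 2] polar[of 3] unfolding polar_det_diagonal[OF e x E]
      by (simp_all add: matrix_unit_def add.commute)
    then have "x$1$1 = 0" "x$2$2 = 0" "x$3$3 = 0" by algebra+
    with x show "x = 0" by (auto simp: vec_eq_iff forall_3 diagonal_matrices_def)
  qed
  have "polar det (matrix_unit i) (matrix_unit i) z = 0" if "z \<in> diagonal_matrices" for i z
    using polar_det_diagonal[OF E E that, of i i] exhaust_3[of i] by (auto simp: matrix_unit_def)
  moreover have "matrix_unit 2 \<noteq> matrix_unit 3"
    by (auto simp: vec_eq_iff matrix_unit_def)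
  ultimately show ?thesis
    using not_involutive_three_null[OF nd E E E] by blast
qed

section \<open>Composition algebras\<close>

text \<open>
  The properties of \<open>\<real>\<close>, \<open>\<C>\<close>, \<open>\<H>\<close> and \<open>\<O>\<close> that survive every Cayley-Dickson step.  Associativity and
  the multiplicativity of the norm do not, which is why only \<open>x x\<^sup>* = x\<^sup>* x = |x|\<^sup>2\<close> is kept.
\<close>

locale norm_algebra =
  fixes A :: "('a::real_inner) conj_algebra"
  assumes bilinear: "bilinear (amult A)"
    and linear_conj: "linear (aconj A)"
    and conj_conj [simp]: "aconj A (aconj A x) = x"
    and conj_one [simp]: "aconj A (aone A) = aone A"
    and one_mult [simp]: "amult A (aone A) x = x"
    and mult_one [simp]: "amult A x (aone A) = x"
    and mult_conj: "amult A x (aconj A x) = (x \<bullet> x) *\<^sub>R aone A"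
    and conj_mult: "amult A (aconj A x) x = (x \<bullet> x) *\<^sub>R aone A"
    and conj_fixed: "aconj A x = x \<Longrightarrow> \<exists>r. x = r *\<^sub>R aone A"
    and one_nonzero: "aone A \<noteq> 0"
begin

lemmas mult_simps = bilinear_ladd[OF bilinear] bilinear_radd[OF bilinear]
  bilinear_lsub[OF bilinear] bilinear_rsub[OF bilinear]
  bilinear_lmul[OF bilinear] bilinear_rmul[OF bilinear]
  bilinear_lneg[OF bilinear] bilinear_rneg[OF bilinear]
  bilinear_lzero[OF bilinear] bilinear_rzero[OF bilinear]

lemmas conj_simps = linear_add[OF linear_conj] linear_diff[OF linear_conj] linear_scale[OF
    linear_conj]
  linear_neg[OF linear_conj] linear_0[OF linear_conj]

end

lemma norm_algebra_real: "norm_algebra real_algebra"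
  by unfold_locales
    (auto simp: real_algebra_def bilinear_def linear_iff algebra_simps intro: exI[of _ "_ :: real"])

lemma norm_algebra_complex: "norm_algebra complex_algebra"
proof
  fix x :: complex
  show "aconj complex_algebra x = x \<Longrightarrow> \<exists>r. x = r *\<^sub>R aone complex_algebra"
    by (rule exI[of _ "Re x"]) (simp add: complex_algebra_def complex_eq_iff)
qed (auto simp: complex_algebra_def bilinear_def linear_iff complex_eq_iff inner_complex_def
    algebra_simps)

lemma norm_algebra_cayley_dickson:
  assumes "norm_algebra A"
  shows "norm_algebra (cayley_dickson A)"
proof -
  interpret norm_algebra A by (rule assms)
  show ?thesis
  proof (rule norm_algebra.intro)
    show "bilinear (amult (cayley_dickson A))"
      by (auto simp: cayley_dickson_def bilinear_def linear_iff mult_simps conj_simps algebra_simps)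
    show "linear (aconj (cayley_dickson A))"
      by (auto simp: cayley_dickson_def linear_iff conj_simps)
    show "\<exists>r. x = r *\<^sub>R aone (cayley_dickson A)" if "aconj (cayley_dickson A) x = x" for x
    proof -
      obtain a b where x: "x = (a, b)" by (cases x)
      have "aconj A a = a" "- b = b"
        using that by (simp_all add: x cayley_dickson_def)
      moreover from this have "2 *\<^sub>R b = 0" by (simp add: scaleR_2 neg_eq_iff_add_eq_0)
      ultimately have "aconj A a = a" "b = 0" by simp_all
      then show ?thesis using conj_fixed[of a] by (auto simp: x cayley_dickson_def)
    qed
  qed (auto simp: cayley_dickson_def mult_simps conj_simps mult_conj conj_mult one_nonzero
      scaleR_left_distrib zero_prod_def split: prod.splits)
qed

lemma vector_space_cscale: "vector_space (cscale :: complex \<Rightarrow> 'a::real_vector \<times> 'a \<Rightarrow> _)"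
  by unfold_locales (auto simp: cscale_def algebra_simps)

interpretation csc: vector_space "cscale :: complex \<Rightarrow> 'a::real_vector \<times> 'a \<Rightarrow> 'a \<times> 'a"
  by (rule vector_space_cscale)

lemma vector_space_hscale: "vector_space (hscale :: complex \<Rightarrow> ('a::real_vector \<times> 'a)^3^3 \<Rightarrow> _)"
  by unfold_locales (simp_all add: hscale_def vec_eq_iff csc.scale_left_distrib
      csc.scale_right_distrib)

interpretation hsc: vector_space "hscale :: complex \<Rightarrow> ('a::real_vector \<times> 'a)^3^3 \<Rightarrow> _"
  by (rule vector_space_hscale)

text \<open>
  The corresponding properties of the complexification, with the complex quadratic form \<open>q\<close> in place
  of the squared norm.
\<close>

locale quadratic_conj_algebra =
  fixes B :: "('a::real_vector \<times> 'a) conj_algebra" and q :: "'a \<times> 'a \<Rightarrow> complex"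
  assumes add_mult: "amult B (x + y) z = amult B x z + amult B y z"
    and mult_add: "amult B x (y + z) = amult B x y + amult B x z"
    and scale_mult: "amult B (cscale c x) y = cscale c (amult B x y)"
    and mult_scale: "amult B x (cscale c y) = cscale c (amult B x y)"
    and conj_add: "aconj B (x + y) = aconj B x + aconj B y"
    and conj_scale: "aconj B (cscale c x) = cscale c (aconj B x)"
    and conj_conj [simp]: "aconj B (aconj B x) = x"
    and conj_one [simp]: "aconj B (aone B) = aone B"
    and one_mult [simp]: "amult B (aone B) x = x"
    and mult_one [simp]: "amult B x (aone B) = x"
    and mult_conj [simp]: "amult B x (aconj B x) = cscale (q x) (aone B)"
    and conj_mult [simp]: "amult B (aconj B x) x = cscale (q x) (aone B)"
    and conj_fixed: "aconj B x = x \<Longrightarrow> \<exists>z. x = cscale z (aone B)"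
    and one_nonzero: "aone B \<noteq> 0"
    and q_nondegenerate: "(\<And>y. q (x + y) = q x + q y) \<Longrightarrow> x = 0"

text \<open>
  The form is \<open>q(a + b \<i>) = |a|\<^sup>2 - |b|\<^sup>2 + 2 \<langle>a, b\<rangle> \<i>\<close>.  It is nondegenerate since the polar form of
  \<open>a + b \<i>\<close> with its complex conjugate \<open>a - b \<i>\<close> is \<open>2 |a|\<^sup>2 + 2 |b|\<^sup>2\<close>.
\<close>

lemma quadratic_conj_algebra_complexify:
  assumes "norm_algebra A"
  shows "quadratic_conj_algebra (complexify A) (\<lambda>(a, b). Complex (a \<bullet> a - b \<bullet> b) (2 * (a \<bullet> b)))"
proof -
  interpret norm_algebra A by (rule assms)
  have polarize: "amult A a (aconj A b) + amult A b (aconj A a) = (2 * (a \<bullet> b)) *\<^sub>R aone A"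
      "amult A (aconj A a) b + amult A (aconj A b) a = (2 * (a \<bullet> b)) *\<^sub>R aone A" for a b
    using mult_conj[of "a + b"] conj_mult[of "a + b"]
    by (simp_all add: mult_simps conj_simps mult_conj conj_mult inner_add inner_commute
        algebra_simps)
  show ?thesis
  proof
    fix x y z :: "'a \<times> 'a" and c :: complex
    let ?B = "complexify A" and ?q = "\<lambda>(a, b). Complex (a \<bullet> a - b \<bullet> b) (2 * (a \<bullet> b)) :: complex"
    show "amult ?B x (aconj ?B x) = cscale (?q x) (aone ?B)"
      using polarize(1)[of "fst x" "snd x"]
      by (cases x) (simp add: complexify_def cscale_def mult_conj scaleR_left_diff_distrib)
    show "amult ?B (aconj ?B x) x = cscale (?q x) (aone ?B)"
      using polarize(2)[of "fst x" "snd x"]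
      by (cases x) (simp add: complexify_def cscale_def conj_mult scaleR_left_diff_distrib)
    show "\<exists>z. x = cscale z (aone ?B)" if fixed: "aconj ?B x = x"
    proof -
      obtain a b where x: "x = (a, b)" by (cases x)
      then have "aconj A a = a" "aconj A b = b"
        using fixed by (simp_all add: complexify_def)
      then obtain r s where "a = r *\<^sub>R aone A" "b = s *\<^sub>R aone A"
        using conj_fixed by blast
      then have "x = cscale (Complex r s) (aone ?B)" by (simp add: x complexify_def cscale_def)
      then show ?thesis ..
    qed
    show "x = 0" if "\<And>y. ?q (x + y) = ?q x + ?q y"
    proof -
      obtain a b where x: "x = (a, b)" by (cases x)
      have "2 * (a \<bullet> a + b \<bullet> b) = 0"
        using that[of "(a, - b)"] by (simp add: x complex_eq_iff inner_add inner_diff algebra_simps)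
      then have "a \<bullet> a + b \<bullet> b = 0" by simp
      then have "a \<bullet> a = 0 \<and> b \<bullet> b = 0"
        by (subst (asm) add_nonneg_eq_0_iff) simp_all
      then show ?thesis by (simp add: x zero_prod_def)
    qed
  qed (simp_all add: complexify_def cscale_def mult_simps conj_simps one_nonzero zero_prod_def
      algebra_simps
      case_prod_unfold prod_eq_iff)
qed

section \<open>The determinant of a Hermitian matrix\<close>

context quadratic_conj_algebra
begin

lemma zero_simps [simp]: "amult B 0 x = 0" "amult B x 0 = 0" "aconj B 0 = 0" "q 0 = 0"
proof -
  show *: "amult B 0 x = 0" for x
    using add_mult[of 0 0 x] by simp
  show "amult B x 0 = 0" "aconj B 0 = 0"
    using mult_add[of x 0 0] conj_add[of 0 0] by simp_all
  have "cscale (q 0) (aone B) = 0"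
    using mult_conj[of 0] by (simp only: *)
  then show "q 0 = 0"
    using one_nonzero by simp
qed

lemma neg_simps [simp]: "amult B (- x) y = - amult B x y" "amult B x (- y) = - amult B x y"
proof -
  show "amult B (- x) y = - amult B x y"
    using add_mult[of "- x" x y] by (simp add: eq_neg_iff_add_eq_0)
  show "amult B x (- y) = - amult B x y"
    using mult_add[of x "- y" y] by (simp add: eq_neg_iff_add_eq_0)
qed

text \<open>
  Fix distinct positions \<open>i\<close> and \<open>j\<close> and an element \<open>x\<close>.  The matrices with an arbitrary scalar diagonal
  and a multiple of \<open>x\<close> in position \<open>(i, j)\<close> form a Jordan subalgebra, parametrized by the
  diagonal \<open>d\<close> and the multiple \<open>w\<close>; the characteristic equation can be evaluated inside it.
\<close>

definition block :: "3 \<Rightarrow> 3 \<Rightarrow> 'a \<times> 'a \<Rightarrow> (3 \<Rightarrow> complex) \<Rightarrow> complex \<Rightarrow> ('a \<times> 'a)^3^3" where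
  "block i j x d w = (\<chi> r c. if r = c then cscale (d r) (aone B)
     else if r = i \<and> c = j then cscale w x else if r = j \<and> c = i then cscale w (aconj B x) else 0)"

lemma block_linear:
  "block i j x d w + block i j x d' w' = block i j x (\<lambda>r. d r + d' r) (w + w')"
  "block i j x d w - block i j x d' w' = block i j x (\<lambda>r. d r - d' r) (w - w')"
  "hscale z (block i j x d w) = block i j x (\<lambda>r. z * d r) (z * w)"
  "hid B = block i j x (\<lambda>_. 1) 0"
  by (auto simp: block_def hscale_def hid_def vec_eq_iff csc.scale_left_distrib
      csc.scale_left_diff_distrib)

lemma sum_UNIV_3:
  fixes i j k :: 3 and f :: "3 \<Rightarrow> 'c::comm_monoid_add"
  assumes "distinct [i, j, k]"
  shows "(\<Sum>l\<in>UNIV. f l) = f i + f j + f k" and "l = i \<or> l = j \<or> l = k"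
proof -
  have "card {i, j, k} = CARD(3)" using assms by simp
  then have "{i, j, k} = (UNIV :: 3 set)" by (intro card_subset_eq) auto
  then show "l = i \<or> l = j \<or> l = k" by blast
  have "(\<Sum>l\<in>{i, j, k}. f l) = f i + f j + f k" using assms by (simp add: add.assoc)
  then show "(\<Sum>l\<in>UNIV. f l) = f i + f j + f k" using \<open>{i, j, k} = UNIV\<close> by simp
qed

lemma jordan_block:
  assumes ijk: "distinct [i, j, k]"
  shows "jordan B (block i j x d w) (block i j x d' w') =
    block i j x (\<lambda>r. d r * d' r + (if r = k then 0 else w * w' * q x))
      (((d i + d j) * w' + (d' i + d' j) * w) / 2)"
proof -
  have ne: "i \<noteq> j" "j \<noteq> i" "i \<noteq> k" "k \<noteq> i" "j \<noteq> k" "k \<noteq> j"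
    using ijk by auto
  note simps = ne block_def jordan_def hmult_def hscale_def sum_UNIV_3(1)[OF ijk] scale_mult
      mult_scale
    csc.scale_left_distrib[symmetric] csc.scale_right_distrib
  have "jordan B (block i j x d w) (block i j x d' w') $ r $ c =
    block i j x (\<lambda>r. d r * d' r + (if r = k then 0 else w * w' * q x))
      (((d i + d j) * w' + (d' i + d' j) * w) / 2) $ r $ c" for r c
    using sum_UNIV_3(2)[OF ijk, of r] sum_UNIV_3(2)[OF ijk, of c]
    by (elim disjE; simp add: simps del: csc.scale_cancel_right; (rule arg_cong2[where f=cscale,
        OF _ refl])?; simp add: field_simps)
  then show ?thesis by (simp add: vec_eq_iff)
qed

lemma htrace_block:
  assumes ijk: "distinct [i, j, k]"
  shows "htrace B (block i j x d w) = d i + d j + d k"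
proof -
  have "(\<Sum>l\<in>UNIV. block i j x d w $ l $ l) = cscale (d i + d j + d k) (aone B)"
    by (simp add: sum_UNIV_3(1)[OF ijk] block_def csc.scale_left_distrib)
  then show ?thesis by (simp add: htrace_def one_nonzero)
qed

text \<open>
  The characteristic expression of \<open>H\<close> lies in the subalgebra again.  Its off-diagonal parameter
  vanishes and its diagonal parameter is the constant \<open>D - e\<close>, so \<open>e = D\<close> is the unique solution.
\<close>

lemma hdet_block:
  assumes ijk: "distinct [i, j, k]"
  shows "hdet B (block i j x d 1) = d i * d j * d k - d k * q x"
proof -
  have block0: "block i j x (\<lambda>r. D - e) 0 = 0 \<longleftrightarrow> e = D" for D e
  proof
    assume "block i j x (\<lambda>r. D - e) 0 = 0"
    then have "block i j x (\<lambda>r. D - e) 0 $ i $ i = 0" by simp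
    then have "cscale (D - e) (aone B) = 0" by (simp add: block_def)
    then show "e = D" using one_nonzero by simp
  qed (auto simp: block_def vec_eq_iff)
  let ?H = "block i j x"
  define d2 where "d2 = (\<lambda>r. d r * d r + (if r = k then 0 else q x))"
  have X2: "jordan B (?H d 1) (?H d 1) = ?H d2 (d i + d j)"
    by (simp add: jordan_block[OF ijk] d2_def add_divide_distrib cong: if_cong)
  define d3 where "d3 = (\<lambda>r. d r * d2 r + (if r = k then 0 else (d i + d j) * q x))"
  define w3 where "w3 = ((d i + d j) * (d i + d j) + (d2 i + d2 j)) / 2"
  have X3: "jordan B (?H d 1) (?H d2 (d i + d j)) = ?H d3 w3"
    unfolding jordan_block[OF ijk] d3_def w3_def by (simp cong: if_cong)
  define t where "t = d i + d j + d k"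
  define t2 where "t2 = d2 i + d2 j + d2 k"
  define D where "D = d i * d j * d k - d k * q x"
  have w: "w3 - t * (d i + d j) - 1/2 * (t2 - t\<^sup>2) * 1 - e * 0 = 0" for e
    using ijk by (simp add: w3_def t_def t2_def d2_def field_simps power2_eq_square)
  have diag: "d3 r - t * d2 r - 1/2 * (t2 - t\<^sup>2) * d r - e * 1 = D - e" for r e
    using sum_UNIV_3(2)[OF ijk, of r] ijk
    by (elim disjE) (simp_all add: D_def d3_def t_def t2_def d2_def field_simps power2_eq_square)
  have "?H d3 w3 - hscale t (?H d2 (d i + d j)) - hscale (1/2 * (t2 - t\<^sup>2)) (?H d 1) - hscale e
      (hid B)
      = ?H (\<lambda>r. D - e) 0" for e
    unfolding block_linear(4)[of i j x] block_linear(2,3) w diag ..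
  then show ?thesis
    unfolding hdet_def Let_def X2 X3 htrace_block[OF ijk] t_def[symmetric] t2_def[symmetric]
        D_def[symmetric]
    by (simp add: block0)
qed

subsection \<open>Sign changes\<close>

text \<open>
  Conjugation by the diagonal matrix with entry \<open>-1\<close> in position \<open>i\<close> and \<open>1\<close> elsewhere.  It is an
  automorphism of the Jordan algebra over any \<open>B\<close>, associative or not, and so it preserves the
  determinant.
\<close>

definition flip :: "3 \<Rightarrow> ('a \<times> 'a)^3^3 \<Rightarrow> ('a \<times> 'a)^3^3" where
  "flip i H = (\<chi> r c. if (r = i) = (c = i) then H$r$c else - H$r$c)"

lemma flip_linear:
  "flip i (H + Y) = flip i H + flip i Y" "flip i (H - Y) = flip i H - flip i Y"
  "flip i (hscale z H) = hscale z (flip i H)" "flip i H = 0 \<longleftrightarrow> H = 0"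
  by (auto simp: flip_def vec_eq_iff hscale_def)

lemma hmult_flip: "hmult B (flip i H) (flip i Y) = flip i (hmult B H Y)"
proof -
  have "hmult B (flip i H) (flip i Y) $ r $ c = flip i (hmult B H Y) $ r $ c" for r c
    by (cases "r = i"; cases "c = i") (auto simp: hmult_def flip_def sum_negf[symmetric] intro!:
        sum.cong)
  then show ?thesis by (simp add: vec_eq_iff)
qed

lemma hdet_flip: "hdet B (flip i H) = hdet B H"
proof -
  have J: "jordan B (flip i H) (flip i Y) = flip i (jordan B H Y)" for H Y
    by (simp add: jordan_def hmult_flip flip_linear)
  have t: "htrace B (flip i H) = htrace B H" for H
    by (simp add: htrace_def flip_def)
  have id: "hid B = flip i (hid B)"
    by (auto simp: hid_def flip_def vec_eq_iff)
  show ?thesis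
    unfolding hdet_def Let_def J t
    by (subst id) (simp only: flip_linear(2,3)[symmetric] flip_linear(4))
qed

lemma polar_flip: "polar (hdet B) (flip i H) (flip i Y) (flip i Z) = polar (hdet B) H Y Z"
  by (simp only: polar_def flip_linear(1)[symmetric] hdet_flip)

lemma hermitian_iff: "H \<in> hermitian_matrices B \<longleftrightarrow> (\<forall>i j. aconj B (H$j$i) = H$i$j)"
  unfolding hermitian_matrices_def mem_Collect_eq by (intro iffI allI) (rule sym, blast)+

lemma hermitian_closed:
  assumes "H \<in> hermitian_matrices B" "Y \<in> hermitian_matrices B"
  shows "H + Y \<in> hermitian_matrices B" "H - Y \<in> hermitian_matrices B" "hscale z H \<in>
      hermitian_matrices B"
    "flip i H \<in> hermitian_matrices B"
proof -
  have conj_neg: "aconj B (- x) = - aconj B x" for x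
    using conj_add[of x "- x"] by (simp add: eq_neg_iff_add_eq_0 add.commute)
  have conj_diff: "aconj B (x - y) = aconj B x - aconj B y" for x y
    using conj_add[of x "- y"] by (simp add: conj_neg)
  show "H + Y \<in> hermitian_matrices B" "H - Y \<in> hermitian_matrices B" "hscale z H \<in>
      hermitian_matrices B"
    using assms by (simp_all add: hermitian_iff hscale_def conj_add conj_diff conj_scale)
  show "flip i H \<in> hermitian_matrices B"
    using assms by (auto simp: hermitian_iff flip_def conj_neg)
qed

lemma block_hermitian: "i \<noteq> j \<Longrightarrow> block i j x d w \<in> hermitian_matrices B"
  by (auto simp: hermitian_iff block_def conj_scale)

definition diagonal :: "(3 \<Rightarrow> complex) \<Rightarrow> ('a \<times> 'a)^3^3" where
  "diagonal d = (\<chi> r c. if r = c then cscale (d r) (aone B) else 0)"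

lemma diagonal_block: "diagonal d = block i j 0 d 1" "diagonal d = block i j x d 0"
  by (auto simp: diagonal_def block_def vec_eq_iff)

lemma diagonal_hermitian: "diagonal d \<in> hermitian_matrices B"
  by (auto simp: hermitian_iff diagonal_def conj_scale)

lemma hermitian_diagonalE:
  assumes "H \<in> hermitian_matrices B" "\<And>r c. r \<noteq> c \<Longrightarrow> H$r$c = 0"
  obtains d where "H = diagonal d"
proof -
  have "aconj B (H$r$r) = H$r$r" for r using assms(1) unfolding hermitian_iff by blast
  then have "\<exists>z. H$r$r = cscale z (aone B)" for r by (rule conj_fixed)
  then obtain d where "H$r$r = cscale (d r) (aone B)" for r by metis
  then have "H = diagonal d" using assms(2) by (auto simp: diagonal_def vec_eq_iff)
  then show thesis by (rule that)
qed

lemma diagonal_add: "diagonal d + diagonal d' = diagonal (\<lambda>r. d r + d' r)"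
  by (simp add: diagonal_def vec_eq_iff csc.scale_left_distrib)

lemma hdet_diagonal: "hdet B (diagonal d) = d 1 * d 2 * d 3"
  using hdet_block[of 1 2 3 0 d] by (simp add: diagonal_block(1)[of d 1 2])

lemma polar_diagonal:
  "polar (hdet B) (diagonal d) (diagonal d') (diagonal d'') =
    (d 1 * (d' 2 * d'' 3 + d' 3 * d'' 2) + d 2 * (d' 1 * d'' 3 + d' 3 * d'' 1) + d 3 * (d' 1 *
        d'' 2 + d' 2 * d'' 1)) / 6"
  by (simp add: polar_def diagonal_add hdet_diagonal algebra_simps)

lemma flip_diagonal: "flip i (diagonal d) = diagonal d"
  by (auto simp: flip_def diagonal_def vec_eq_iff)

lemma polar_off_diagonal:
  assumes ijk: "distinct [i, j, k]"
  shows "polar (hdet B) (diagonal (\<lambda>_. 1)) (block i j x (\<lambda>_. 0) 1) (block i j y (\<lambda>_. 0) 1)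
    = (q x + q y - q (x + y)) / 6"
proof -
  have add: "block i j x d 1 + block i j y d' 1 = block i j (x + y) (\<lambda>r. d r + d' r) 1" for x y d d'
    by (auto simp: block_def vec_eq_iff csc.scale_left_distrib conj_add)
  show ?thesis
    unfolding diagonal_block(1)[of _ i j] polar_def add
    by (simp add: hdet_block[OF ijk])
qed

end

text \<open>
  Sign changes fix diagonal matrices.  Averaging over two of them therefore replaces \<open>X\<close> by its
  diagonal part in \<open>C(E\<^sub>l, E\<^sub>l, X)\<close>, which vanishes as in the diagonal case.  Similarly, if \<open>Y\<close> has its only
  nonzero entries in positions \<open>(i, j)\<close> and \<open>(j, i)\<close>, then \<open>C(1, Y, X)\<close> only depends on the entry
  \<open>X\<^sub>i\<^sub>j\<close>, and is \<open>-1/6\<close> times the polar form of \<open>q\<close> on \<open>X\<^sub>i\<^sub>j\<close> and \<open>Y\<^sub>i\<^sub>j\<close>.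
\<close>

theorem hermitian_not_involutive:
  fixes A :: "('a::real_inner) conj_algebra"
  assumes A: "norm_algebra A" and C: "hermitian_cubic A C"
  shows "\<not> involutive_tableau (I_forms C) (J_fibre C) omega dt p"
proof -
  define B where "B = complexify A"
  define q :: "'a \<times> 'a \<Rightarrow> complex" where "q = (\<lambda>(a, b). Complex (a \<bullet> a - b \<bullet> b) (2 * (a \<bullet> b)))"
  interpret quadratic_conj_algebra B q
    unfolding B_def q_def by (rule quadratic_conj_algebra_complexify[OF A])
  interpret cubic_model hscale "hermitian_matrices B" "hdet B" C
    by unfold_locales (rule C[unfolded hermitian_cubic_def B_def[symmetric]])
  let ?W = "hermitian_matrices B" and ?N = "hdet B"
  define E where "E i = diagonal (\<lambda>r. if r = i then 1 else 0)" for i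
  have E: "E i \<in> ?W" for i by (simp add: E_def diagonal_hermitian)
  have e: "E 1 + E 2 + E 3 = diagonal (\<lambda>_. 1)"
  proof -
    have "(\<lambda>r. (if r = 1 then 1 else 0) + (if r = 2 then 1 else 0) + (if r = 3 then 1 else 0)) =
        (\<lambda>_::3. 1::complex)"
      using exhaust_3 by (auto simp: fun_eq_iff)
    then show ?thesis by (simp add: E_def diagonal_add)
  qed

  \<comment> \<open>Averaging over a sign change projects onto its fixed matrices.\<close>
  define avg where "avg i H = hscale (1/2) (H + flip i H)" for i and H :: "('a \<times> 'a)^3^3"
  have avg_W: "avg i H \<in> ?W" if "H \<in> ?W" for i H
    unfolding avg_def using that by (intro hermitian_closed)
  have avg_nth: "avg i H $ r $ c = (if (r = i) = (c = i) then H$r$c else 0)" for i H r c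
    by (auto simp: avg_def flip_def hscale_def csc.scale_right_distrib simp flip:
        csc.scale_left_distrib)
  have polar_avg: "polar ?N Y Y' (avg i H) = polar ?N Y Y' H"
    if "Y \<in> ?W" "Y' \<in> ?W" "H \<in> ?W" "flip i Y = Y" "flip i Y' = Y'" for Y Y' H i
  proof -
    have W: "flip i H \<in> ?W" "H + flip i H \<in> ?W"
      using that by (auto intro: hermitian_closed)
    have "polar ?N Y Y' (flip i H) = polar ?N Y Y' H"
      using polar_flip[of i Y Y' H] that by simp
    then show ?thesis
      unfolding avg_def using that W by (simp add: polar_linear)
  qed

  have null: "polar ?N (E l) (E l) H = 0" if H: "H \<in> ?W" for l H
  proof -
    have zero: "avg 1 (avg 2 H) $ r $ c = 0" if "r \<noteq> c" for r c
      using that exhaust_3[of r] exhaust_3[of c] by (elim disjE; simp add: avg_nth)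
    obtain d where d: "avg 1 (avg 2 H) = diagonal d"
      by (rule hermitian_diagonalE[OF avg_W[OF avg_W[OF H]] zero])
    have "polar ?N (E l) (E l) H = polar ?N (E l) (E l) (diagonal d)"
      unfolding d[symmetric] using H E avg_W by (simp add: polar_avg E_def flip_diagonal)
    also have "\<dots> = 0"
      using exhaust_3[of l] by (auto simp: E_def polar_diagonal)
    finally show ?thesis .
  qed

  have nd: "nondegenerate_in ?W ?N (diagonal (\<lambda>_. 1))"
    unfolding nondegenerate_in_def
  proof (intro conjI ballI impI diagonal_hermitian)
    fix H assume H: "H \<in> ?W" and H0: "\<forall>Z\<in>?W. polar ?N (diagonal (\<lambda>_. 1)) H Z = 0"
    have off: "H$i$j = 0" if ij: "i \<noteq> j" for i j
    proof -
      have "\<exists>k. k \<noteq> i \<and> k \<noteq> j"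
        using exhaust_3[of i] exhaust_3[of j] by (elim disjE) (simp_all, (rule exI[of _ 1]
            exI[of _ 2] exI[of _ 3], simp; fail)+)
      then obtain k where "k \<noteq> i \<and> k \<noteq> j" ..
      with ij have ijk: "distinct [i, j, k]" by auto
      then have ne: "i \<noteq> j" "j \<noteq> i" "i \<noteq> k" "k \<noteq> i" "j \<noteq> k" "k \<noteq> j" by auto
      let ?Y = "\<lambda>y. block i j y (\<lambda>_. 0) 1"
      \<comment> \<open>the part of \<open>H\<close> in the positions with exactly one index equal to \<open>i\<close>; averaging over the
        sign change at the third index \<open>k\<close> leaves the positions \<open>(i, j)\<close> and \<open>(j, i)\<close>\<close>
      define H1 where "H1 = H - avg i H"
      have H1: "H1 \<in> ?W" unfolding H1_def using H avg_W by (intro hermitian_closed)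
      have "avg k H1 $ r $ c = ?Y (H$i$j) $ r $ c" for r c
      proof -
        have "H$j$i = aconj B (H$i$j)" using H unfolding hermitian_iff by metis
        then show ?thesis
          using sum_UNIV_3(2)[OF ijk, of r] sum_UNIV_3(2)[OF ijk, of c]
          by (elim disjE) (simp_all add: avg_nth H1_def block_def ne)
      qed
      then have slot: "avg k H1 = ?Y (H$i$j)" by (simp add: vec_eq_iff)
      have "q (H$i$j + y) = q (H$i$j) + q y" for y
      proof -
        let ?e = "diagonal (\<lambda>_. 1)"
        have Y: "?Y y \<in> ?W" using ij by (rule block_hermitian)
        have fk: "flip k (?Y y) = ?Y y"
          using ijk by (auto simp: flip_def block_def vec_eq_iff)
        have fi: "flip i (?Y y) = 0 - ?Y y"
          using ij by (auto simp: flip_def block_def vec_eq_iff)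
        \<comment> \<open>the sign change at \<open>i\<close> fixes \<open>1\<close> and \<open>avg i H\<close>, but negates \<open>Y\<close>\<close>
        have "polar ?N ?e (?Y y) (avg i H) = 0"
        proof -
          have "polar ?N ?e (?Y y) (avg i H) = polar ?N ?e (avg i H) (?Y y)"
            by (rule polar_swap)
          also have "\<dots> = polar ?N (flip i ?e) (flip i (avg i H)) (flip i (?Y y))"
            by (rule polar_flip[symmetric])
          also have "flip i (avg i H) = avg i H"
            by (auto simp: vec_eq_iff flip_def avg_nth)
          also have "polar ?N (flip i ?e) (avg i H) (flip i (?Y y)) = - polar ?N ?e (avg i H)
              (?Y y)"
            unfolding flip_diagonal fi
            using polar_linear(2)[of ?e "avg i H" "0" "?Y y"] polar_linear(3)[of ?e "avg i H"
                "?Y y" "?Y y" 0]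
              diagonal_hermitian avg_W H Y hermitian_closed(3)[OF Y Y, of 0] by simp
          also have "polar ?N ?e (avg i H) (?Y y) = polar ?N ?e (?Y y) (avg i H)"
            by (rule polar_swap)
          finally show ?thesis by (simp add: eq_neg_iff_add_eq_0)
        qed
        moreover have "polar ?N ?e (?Y y) H = 0"
          using H0 Y by (simp add: polar_swap(2)[of _ _ "?Y y" H])
        ultimately have "polar ?N ?e (?Y y) H1 = 0"
          unfolding H1_def using diagonal_hermitian Y H avg_W by (simp add: polar_linear)
        then have "polar ?N ?e (?Y y) (?Y (H$i$j)) = 0"
          unfolding slot[symmetric] using diagonal_hermitian Y H1 fk flip_diagonal by (simp add:
              polar_avg)
        then show ?thesis
          unfolding polar_off_diagonal[OF ijk] by (simp add: add.commute)
      qed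
      then show ?thesis by (rule q_nondegenerate)
    qed
    obtain d where d: "H = diagonal d"
      by (rule hermitian_diagonalE[OF H off])
    have "polar ?N (diagonal (\<lambda>_. 1)) (diagonal d) (E l) = 0" for l
      using H0 E d by blast
    from this[of 1] this[of 2] this[of 3] have "d 2 + d 3 = 0" "d 1 + d 3 = 0" "d 1 + d 2 = 0"
      unfolding E_def polar_diagonal by (simp_all add: add.commute)
    then have "d 1 = 0" "d 2 = 0" "d 3 = 0" by algebra+
    then have "d r = 0" for r using exhaust_3[of r] by auto
    then show "H = 0" by (simp add: d diagonal_def vec_eq_iff)
  qed

  have "E 2 \<noteq> E 3"
    using one_nonzero by (auto simp: E_def diagonal_def vec_eq_iff)
  with nd[folded e] E null show ?thesis
    by (intro not_involutive_three_null)
qed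

section \<open>The involutive systems\<close>

lemma associated_cubic_symmetric: "associated_cubic G C \<Longrightarrow> symmetric_array C"
  unfolding symmetric_array_def
  by (cases G) (auto simp: spin_factor_cubic_def hermitian_cubic_def cubic_in_basis_def split:
      if_splits)

theorem not_involutive_system:
  assumes "valid_type G" and "associated_cubic G C" and "G \<noteq> TypeG2" "G \<noteq> TypeB 3"
  shows "\<not> involutive_tableau (I_forms C) (J_fibre C) omega dt p"
proof (cases G)
  case (TypeB l)
  then show ?thesis
    using assms by (intro spin_factor_not_involutive[of "2 * l - 5"]) auto
next
  case (TypeD l)
  show ?thesis
  proof (cases "l = 4")
    case True
    then show ?thesis using assms TypeD by (simp add: diagonal_not_involutive)
  next
    case False
    then show ?thesis
      using assms TypeD by (intro spin_factor_not_involutive[of "2 * l - 6"]) auto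
  qed
next
  case TypeE6
  then show ?thesis using assms hermitian_not_involutive[OF norm_algebra_complex] by simp
next
  case TypeE7
  then show ?thesis
    using assms hermitian_not_involutive[OF norm_algebra_cayley_dickson[OF norm_algebra_complex]]
    by (simp add: quaternion_algebra_def)
next
  case TypeE8
  then show ?thesis
    using assms hermitian_not_involutive[OF
        norm_algebra_cayley_dickson[OF norm_algebra_cayley_dickson[OF norm_algebra_complex]]]
    by (simp add: octonion_algebra_def quaternion_algebra_def)
next
  case TypeF4
  then show ?thesis using assms hermitian_not_involutive[OF norm_algebra_real] by simp
qed (use assms in auto)

theorem theorem3p10:
  fixes G :: simple_type
    and C :: "'b::finite \<Rightarrow> 'b \<Rightarrow> 'b \<Rightarrow> complex"
    and p :: "complex^'b coord"
  assumes "valid_type G"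
    and "\<And>l. G \<noteq> TypeA l"
    and "\<And>l. G \<noteq> TypeC l"
    and "associated_cubic G C"
  shows "linear_pfaffian (I_forms C) (J_fibre C) \<and>
    (involutive_tableau (I_forms C) (J_fibre C) omega dt p \<longleftrightarrow> G = TypeG2 \<or> G = TypeB 3) \<and>
    (G = TypeG2 \<longrightarrow>
       cartan_character (tableau (I_forms C) (J_fibre C) omega p) 1 = 1 \<and>
       (\<forall>k\<ge>2. cartan_character (tableau (I_forms C) (J_fibre C) omega p) k = 0)) \<and>
    (G = TypeB 3 \<longrightarrow>
       cartan_character (tableau (I_forms C) (J_fibre C) omega p) 1 = 2 \<and>
       (\<forall>k\<ge>2. cartan_character (tableau (I_forms C) (J_fibre C) omega p) k = 0))"
proof -
  let ?s = "cartan_character (tableau (I_forms C) (J_fibre C) omega p)"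
  have C: "symmetric_array C"
    using assms(4) by (rule associated_cubic_symmetric)
  have pfaffian: "linear_pfaffian (I_forms C) (J_fibre C)"
    by (rule structure_equation_imp_linear_pfaffian[OF adapted_coframe_omega_dt
        structure_equation_system[OF C]])
  have G2: "CARD('b) = 1 \<and> (\<exists>e. nondegenerate_at C e \<and> (\<forall>a. \<exists>f. multiplier C f \<and> f e = a))"
    if "G = TypeG2"
    using one_dimensional_involutive[of C] assms(4) that by simp
  have B3: "CARD('b) = 2 \<and> (\<exists>e. nondegenerate_at C e \<and> (\<forall>a. \<exists>f. multiplier C f \<and> f e = a))"
    if "G = TypeB 3"
    using spin_factor_one_involutive[of C] assms(4) that by simp
  have involutive: "involutive_tableau (I_forms C) (J_fibre C) omega dt p"
    and characters: "?s 1 = CARD('b) \<and> (\<forall>k\<ge>2. ?s k = 0)" if "G = TypeG2 \<or> G = TypeB 3"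
  proof -
    have "\<exists>e. nondegenerate_at C e \<and> (\<forall>a. \<exists>f. multiplier C f \<and> f e = a)"
      using that by (elim disjE) (simp_all only: G2 B3)
    then obtain e where e: "nondegenerate_at C e" and surj: "\<forall>a. \<exists>f. multiplier C f \<and> f e = a"
      by (elim exE conjE)
    show "involutive_tableau (I_forms C) (J_fibre C) omega dt p"
      unfolding involutive_system_iff[OF C e] by (rule surj)
    show "?s 1 = CARD('b) \<and> (\<forall>k\<ge>2. ?s k = 0)"
      using cartan_character_system[OF C e] by simp
  qed
  have "involutive_tableau (I_forms C) (J_fibre C) omega dt p \<longleftrightarrow> G = TypeG2 \<or> G = TypeB 3"
    using involutive not_involutive_system[OF assms(1,4)] by blast
  then show ?thesis
    using pfaffian characters G2 B3 by simp
qed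

end
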